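(* Let $0<m\le 1$ and let $\gamma(s)=\gamma(s;m)$ be a symmetric periodic SBC orbit of period $T=2\pi$ and energy $\hat E=\hat E(m)$ of the regularized planar pairwise symmetric four-body problem (PPS4BP), as described in the context. Let $K$ be the associated $4\times 4$ matrix, and let $\lambda_1,\lambda_2$ be the two eigenvalues of $K$ (counted with algebraic multiplicity) that remain after removing one eigenvalue $1$ and one eigenvalue $-1$. Then $\gamma$ is spectrally stable in the PPS4BP if and only if $\lambda_1$ and $\lambda_2$ are real and have absolute value smaller than or equal to $1$. Moreover, if $\lambda_1$ and $\lambda_2$ are real, distinct, have absolute value strictly smaller than $1$, and none of them is equal to $0$ or $\pm 1/\sqrt 2$, then $\gamma$ is linearly stable in the PPS4BP.
   Context: **Regularized Hamiltonian.** Let $m\in(0,1]$ and let $\hat E$ be a real constant (the energy). Write $z=(u_1,u_2,u_3,u_4,v_1,v_2,v_3,v_4)$ and $M_1=v_1u_1-v_2u_2$, $M_2=v_1u_2+v_2u_1$, $M_3=v_3u_3-v_4u_4$, $M_4=v_3u_4+v_4u_3$, $M_5=u_1^2-u_2^2+u_3^2-u_4^2$, $M_6=2u_1u_2+2u_3u_4$, $M_7=u_1^2-u_2^2-u_3^2+u_4^2$, $M_8=2u_1u_2-2u_3u_4$. The regularized Hamiltonian of the PPS4BP is $$\hat\Gamma(z)=\tfrac1{16}\left(1+\tfrac1m\right)\left((v_1^2+v_2^2)(u_3^2+u_4^2)+(v_3^2+v_4^2)(u_1^2+u_2^2)\right)+\tfrac18\left(1-\tfrac1m\right)(M_3M_1+M_4M_2)$$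 $$-\frac{(u_1^2+u_2^2)(u_3^2+u_4^2)}{\sqrt{M_5^2+M_6^2}}-2m(u_1^2+u_2^2+u_3^2+u_4^2)-\frac{m^2(u_1^2+u_2^2)(u_3^2+u_4^2)}{\sqrt{M_7^2+M_8^2}}-\hat E(u_1^2+u_2^2)(u_3^2+u_4^2).$$ The regularized system is $z'=J\nabla\hat\Gamma(z)$, where ${}'=d/ds$, $\hat E$ is held constant, $\nabla$ is the gradient in $z$, and $J=\begin{bmatrix}0&I\\-I&0\end{bmatrix}$ with $I$ the $4\times4$ identity. The angular momentum is $A=\frac12(-v_1u_2+v_2u_1-v_3u_4+v_4u_3)$. **Symmetry matrices.** With $F=\begin{bmatrix}-1&0\\0&1\end{bmatrix}$ and $G=\begin{bmatrix}1&0\\0&1\end{bmatrix}$, in $2\times2$ blocks, $$S_F=\begin{bmatrix}0&F&0&0\\-F&0&0&0\\0&0&0&F\\0&0&-F&0\end{bmatrix},\qquad S_G=\begin{bmatrix}-G&0&0&0\\0&G&0&0\\0&0&G&0\\0&0&0&-G\end{bmatrix}.$$ **Symmetric periodic SBC orbit.** $\gamma(s)=\gamma(s;m)$ denotes a nonconstant $2\pi$-periodic solution of $z'=J\nabla\hat\Gamma(z)$, with $\hat E=\hat E(m)$, along which $M_5^2+M_6^2\ne0$ and $M_7^2+M_8^2\neq0$, lying on $\hat\Gamma=0$ with $A=0$, and satisfying $S_F\gamma(s)=\gamma(s+\pi/2)$ and $S_G\gamma(s)=\gamma(\pi/2-s)$ for all $s$. Its components at $s=0$ satisfy $u_3(0)=u_1(0)$,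 $u_4(0)=-u_2(0)$, $v_3(0)=-v_1(0)$, $v_4(0)=v_2(0)$. Regularized simultaneous binary collisions (SBCs) occur at $s=\pi/4,3\pi/4,5\pi/4,7\pi/4$. **Matrix $Y_0$.** Set $a=u_1'(0)$, $b=u_2'(0)$, $c=v_1'(0)$, $d=v_2'(0)$, $e=\Vert\gamma'(0)\Vert$ (values along $\gamma$), and $$Y_0=\frac1e\begin{bmatrix} c & d & a & b & a & -b & -c & d \\ d & -c & b & -a & b & a & -d & -c \\ c & d & a & b & -a & b & c & -d \\ -d & c & -b & a & b & a & -d & -c \\ -a & b & c & -d & c & d & a & b \\ -b & -a & d & c & d & -c & b & -a \\ a & -b & -c & d & c & d & a & b \\ -b & -a & d & c & -d & c & -b & a\end{bmatrix}.$$ This $Y_0$ is orthogonal and symplectic, and $Y_0^{-1}S_F^TS_GY_0=\begin{bmatrix}I&0\\0&-I\end{bmatrix}$. **Matrices $B$, $W$, $K$.** Let $Y(s)$ be the matrix solution of $\xi'=J\nabla^2\hat\Gamma(\gamma(s))\xi$, $\xi(0)=Y_0$, where $\nabla^2\hat\Gamma$ is the Hessian in $z$. Let $B=Y(\pi/4)$, $\Lambda=Y_0^{-1}S_F^TS_GY_0$, $D=B^{-1}S_GB$, $W=\Lambda D$. Then $Y_0^{-1}Y(2\pi)=W^4$, and $K$ is the $4\times4$ matrix, uniquely determined by $B$, with $\frac12(W+W^{-1})=\begin{bmatrix}K^T&0\\0&K\end{bmatrix}$. The number $1$ is an eigenvalue of $K$ (the first column of $K$ is $[1,0,0,0]^T$),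 and it is a standing assumption that $-1$ is also an eigenvalue of $K$. **Stability.** The characteristic multipliers of $\gamma$ are the eigenvalues of $Y_0^{-1}Y(2\pi)=W^4$. The orbit $\gamma$ is *spectrally stable* if all its characteristic multipliers have modulus $1$. It is *linearly stable* if it is spectrally stable and, in addition, $W$, and hence $W^4$, is semisimple (diagonalizable over $\mathbb C$) when restricted to the four-dimensional $W$-invariant subspace of $\mathbb R^8$ determined by the two pairs of eigenvalues $\mu$ of $W$ with $\frac12(\mu+1/\mu)\in\{\lambda_1,\lambda_2\}$. *)

theory Defs
  imports "HOL-Analysis.Analysis" "HOL-Computational_Algebra.Polynomial"
begin

section \<open>Linear algebra\<close>

definition block2 :: "real^2^2 \<Rightarrow> real^2^2 \<Rightarrow> real^2^2 \<Rightarrow> real^2^2 \<Rightarrow> real^4^4" where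
  "block2 P Q R S = vector
    [vector [P$1$1, P$1$2, Q$1$1, Q$1$2],
     vector [P$2$1, P$2$2, Q$2$1, Q$2$2],
     vector [R$1$1, R$1$2, S$1$1, S$1$2],
     vector [R$2$1, R$2$2, S$2$1, S$2$2]]"

definition block4 :: "real^4^4 \<Rightarrow> real^4^4 \<Rightarrow> real^4^4 \<Rightarrow> real^4^4 \<Rightarrow> real^8^8" where
  "block4 P Q R S = vector
    [vector [P$1$1, P$1$2, P$1$3, P$1$4, Q$1$1, Q$1$2, Q$1$3, Q$1$4],
     vector [P$2$1, P$2$2, P$2$3, P$2$4, Q$2$1, Q$2$2, Q$2$3, Q$2$4],
     vector [P$3$1, P$3$2, P$3$3, P$3$4, Q$3$1, Q$3$2, Q$3$3, Q$3$4],
     vector [P$4$1, P$4$2, P$4$3, P$4$4, Q$4$1, Q$4$2, Q$4$3, Q$4$4],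
     vector [R$1$1, R$1$2, R$1$3, R$1$4, S$1$1, S$1$2, S$1$3, S$1$4],
     vector [R$2$1, R$2$2, R$2$3, R$2$4, S$2$1, S$2$2, S$2$3, S$2$4],
     vector [R$3$1, R$3$2, R$3$3, R$3$4, S$3$1, S$3$2, S$3$3, S$3$4],
     vector [R$4$1, R$4$2, R$4$3, R$4$4, S$4$1, S$4$2, S$4$3, S$4$4]]"

abbreviation cvec :: "real^'n \<Rightarrow> complex^'n" where
  "cvec x \<equiv> (\<chi> i. complex_of_real (x $ i))"

abbreviation cmat :: "real^'n^'m \<Rightarrow> complex^'n^'m" where
  "cmat A \<equiv> map_matrix complex_of_real A"

definition mat_eigenvalue :: "complex^'n^'n \<Rightarrow> complex \<Rightarrow> bool" where
  "mat_eigenvalue A \<mu> \<longleftrightarrow> (\<exists>x. x \<noteq> 0 \<and> A *v x = \<mu> *s x)"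

text \<open>The determinant is taken over the polynomial ring: this is \<open>det (X I - A)\<close>.\<close>

definition charpoly :: "'a::comm_ring_1^'n^'n \<Rightarrow> 'a poly" where
  "charpoly A = det (mat [:0, 1:] - map_matrix (\<lambda>a. [:a:]) A)"

definition gen_eigenspace :: "complex^'n^'n \<Rightarrow> complex \<Rightarrow> (complex^'n) set" where
  "gen_eigenspace A \<mu> = {x. \<exists>k. ((\<lambda>y. (A - mat \<mu>) *v y) ^^ k) x = 0}"

text \<open>Diagonalizability over the complex numbers of the restriction of a real matrix \<open>A\<close> to an
  invariant real subspace \<open>V\<close>: the complexification of \<open>V\<close> has a basis of eigenvectors of \<open>A\<close>.\<close>

definition semisimple_on :: "real^'n^'n \<Rightarrow> (real^'n) set \<Rightarrow> bool" where
  "semisimple_on A V \<longleftrightarrow>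
     (\<exists>X. vec.independent X \<and> vec.span X = vec.span (cvec ` V) \<and>
          (\<forall>x\<in>X. \<exists>\<mu>. cmat A *v x = \<mu> *s x))"


section \<open>Gradient and Hessian\<close>

definition grad :: "(real^'n \<Rightarrow> real) \<Rightarrow> real^'n \<Rightarrow> real^'n" where
  "grad f z = (\<chi> i. frechet_derivative f (at z) (axis i 1))"

definition hessian :: "(real^'n \<Rightarrow> real) \<Rightarrow> real^'n \<Rightarrow> real^'n^'n" where
  "hessian f z = matrix (frechet_derivative (grad f) (at z))"


section \<open>The regularized planar pairwise symmetric four-body problem\<close>

text \<open>Phase points are \<open>z = (u1, u2, u3, u4, v1, v2, v3, v4)\<close>; in the index type \<open>8\<close> the
  numeral \<open>8\<close> equals \<open>0\<close>, so \<open>1, \<dots>, 8\<close> are exactly the eight indices.\<close>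

abbreviation u1 :: "real^8 \<Rightarrow> real" where "u1 z \<equiv> z $ 1"
abbreviation u2 :: "real^8 \<Rightarrow> real" where "u2 z \<equiv> z $ 2"
abbreviation u3 :: "real^8 \<Rightarrow> real" where "u3 z \<equiv> z $ 3"
abbreviation u4 :: "real^8 \<Rightarrow> real" where "u4 z \<equiv> z $ 4"
abbreviation v1 :: "real^8 \<Rightarrow> real" where "v1 z \<equiv> z $ 5"
abbreviation v2 :: "real^8 \<Rightarrow> real" where "v2 z \<equiv> z $ 6"
abbreviation v3 :: "real^8 \<Rightarrow> real" where "v3 z \<equiv> z $ 7"
abbreviation v4 :: "real^8 \<Rightarrow> real" where "v4 z \<equiv> z $ 8"

definition M1 :: "real^8 \<Rightarrow> real" where "M1 z = v1 z * u1 z - v2 z * u2 z"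
definition M2 :: "real^8 \<Rightarrow> real" where "M2 z = v1 z * u2 z + v2 z * u1 z"
definition M3 :: "real^8 \<Rightarrow> real" where "M3 z = v3 z * u3 z - v4 z * u4 z"
definition M4 :: "real^8 \<Rightarrow> real" where "M4 z = v3 z * u4 z + v4 z * u3 z"
definition M5 :: "real^8 \<Rightarrow> real" where "M5 z = (u1 z)\<^sup>2 - (u2 z)\<^sup>2 + (u3 z)\<^sup>2 - (u4 z)\<^sup>2"
definition M6 :: "real^8 \<Rightarrow> real" where "M6 z = 2 * u1 z * u2 z + 2 * u3 z * u4 z"
definition M7 :: "real^8 \<Rightarrow> real" where "M7 z = (u1 z)\<^sup>2 - (u2 z)\<^sup>2 - (u3 z)\<^sup>2 + (u4 z)\<^sup>2"
definition M8 :: "real^8 \<Rightarrow> real" where "M8 z = 2 * u1 z * u2 z - 2 * u3 z * u4 z"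

definition Hamiltonian :: "real \<Rightarrow> real \<Rightarrow> real^8 \<Rightarrow> real" where
  "Hamiltonian m E z =
     1/16 * (1 + 1/m) * (((v1 z)\<^sup>2 + (v2 z)\<^sup>2) * ((u3 z)\<^sup>2 + (u4 z)\<^sup>2)
                        + ((v3 z)\<^sup>2 + (v4 z)\<^sup>2) * ((u1 z)\<^sup>2 + (u2 z)\<^sup>2))
   + 1/8 * (1 - 1/m) * (M3 z * M1 z + M4 z * M2 z)
   - ((u1 z)\<^sup>2 + (u2 z)\<^sup>2) * ((u3 z)\<^sup>2 + (u4 z)\<^sup>2) / sqrt ((M5 z)\<^sup>2 + (M6 z)\<^sup>2)
   - 2 * m * ((u1 z)\<^sup>2 + (u2 z)\<^sup>2 + (u3 z)\<^sup>2 + (u4 z)\<^sup>2)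
   - m\<^sup>2 * ((u1 z)\<^sup>2 + (u2 z)\<^sup>2) * ((u3 z)\<^sup>2 + (u4 z)\<^sup>2) / sqrt ((M7 z)\<^sup>2 + (M8 z)\<^sup>2)
   - E * ((u1 z)\<^sup>2 + (u2 z)\<^sup>2) * ((u3 z)\<^sup>2 + (u4 z)\<^sup>2)"

definition ang_momentum :: "real^8 \<Rightarrow> real" where
  "ang_momentum z = 1/2 * (- v1 z * u2 z + v2 z * u1 z - v3 z * u4 z + v4 z * u3 z)"

definition J :: "real^8^8" where
  "J = block4 0 (mat 1) (- mat 1) 0"

definition matF :: "real^2^2" where "matF = vector [vector [-1, 0], vector [0, 1]]"
definition matG :: "real^2^2" where "matG = mat 1"

definition S_F :: "real^8^8" where
  "S_F = block4 (block2 0 matF (- matF) 0) 0 0 (block2 0 matF (- matF) 0)"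

definition S_G :: "real^8^8" where
  "S_G = block4 (block2 (- matG) 0 0 matG) 0 0 (block2 matG 0 0 (- matG))"

text \<open>In the regularized coordinates one simultaneous binary collision is \<open>u1 = u2 = 0\<close> and the
  other is \<open>u3 = u4 = 0\<close>.\<close>

definition SBC :: "real^8 \<Rightarrow> bool" where
  "SBC z \<longleftrightarrow> (u1 z = 0 \<and> u2 z = 0) \<or> (u3 z = 0 \<and> u4 z = 0)"

text \<open>The last condition follows from the two symmetries: \<open>\<gamma>(\<pi>/4)\<close> is fixed by \<open>S_G\<close>, which forces
  \<open>u1 = u2 = 0\<close> there, and \<open>S_F\<close> exchanges the two kinds of collision.\<close>

definition symmetric_SBC_orbit :: "real \<Rightarrow> real \<Rightarrow> (real \<Rightarrow> real^8) \<Rightarrow> bool" where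
  "symmetric_SBC_orbit m E \<gamma> \<longleftrightarrow>
     (\<forall>s. (\<gamma> has_vector_derivative J *v grad (Hamiltonian m E) (\<gamma> s)) (at s)) \<and>
     (\<forall>s. (M5 (\<gamma> s))\<^sup>2 + (M6 (\<gamma> s))\<^sup>2 \<noteq> 0) \<and>
     (\<forall>s. (M7 (\<gamma> s))\<^sup>2 + (M8 (\<gamma> s))\<^sup>2 \<noteq> 0) \<and>
     \<not> \<gamma> constant_on UNIV \<and>
     (\<forall>s. \<gamma> (s + 2 * pi) = \<gamma> s) \<and>
     (\<forall>s. Hamiltonian m E (\<gamma> s) = 0) \<and>
     (\<forall>s. ang_momentum (\<gamma> s) = 0) \<and>
     (\<forall>s. S_F *v \<gamma> s = \<gamma> (s + pi/2)) \<and>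
     (\<forall>s. S_G *v \<gamma> s = \<gamma> (pi/2 - s)) \<and>
     u3 (\<gamma> 0) = u1 (\<gamma> 0) \<and> u4 (\<gamma> 0) = - u2 (\<gamma> 0) \<and>
     v3 (\<gamma> 0) = - v1 (\<gamma> 0) \<and> v4 (\<gamma> 0) = v2 (\<gamma> 0) \<and>
     (\<forall>s\<in>{pi/4, 3*pi/4, 5*pi/4, 7*pi/4}. SBC (\<gamma> s))"


section \<open>Linearization and stability\<close>

definition Y0 :: "(real \<Rightarrow> real^8) \<Rightarrow> real^8^8" where
  "Y0 \<gamma> = (let w = vector_derivative \<gamma> (at 0);
                a = u1 w; b = u2 w; c = v1 w; d = v2 w; e = norm w in
     (1/e) *\<^sub>R vector
      [vector [ c,  d,  a,  b,  a, -b, -c,  d],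
       vector [ d, -c,  b, -a,  b,  a, -d, -c],
       vector [ c,  d,  a,  b, -a,  b,  c, -d],
       vector [-d,  c, -b,  a,  b,  a, -d, -c],
       vector [-a,  b,  c, -d,  c,  d,  a,  b],
       vector [-b, -a,  d,  c,  d, -c,  b, -a],
       vector [ a, -b, -c,  d,  c,  d,  a,  b],
       vector [-b, -a,  d,  c, -d,  c, -b,  a]])"

definition linearized_solution ::
    "real \<Rightarrow> real \<Rightarrow> (real \<Rightarrow> real^8) \<Rightarrow> (real \<Rightarrow> real^8^8) \<Rightarrow> bool" where
  "linearized_solution m E \<gamma> Y \<longleftrightarrow>
     Y 0 = Y0 \<gamma> \<and>
     (\<forall>s. (Y has_vector_derivative J ** hessian (Hamiltonian m E) (\<gamma> s) ** Y s) (at s))"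

definition mat_Lambda :: "(real \<Rightarrow> real^8) \<Rightarrow> real^8^8" where
  "mat_Lambda \<gamma> = matrix_inv (Y0 \<gamma>) ** transpose S_F ** S_G ** Y0 \<gamma>"

definition mat_D :: "(real \<Rightarrow> real^8^8) \<Rightarrow> real^8^8" where
  "mat_D Y = matrix_inv (Y (pi/4)) ** S_G ** Y (pi/4)"

definition mat_W :: "(real \<Rightarrow> real^8) \<Rightarrow> (real \<Rightarrow> real^8^8) \<Rightarrow> real^8^8" where
  "mat_W \<gamma> Y = mat_Lambda \<gamma> ** mat_D Y"

definition is_mat_K :: "(real \<Rightarrow> real^8) \<Rightarrow> (real \<Rightarrow> real^8^8) \<Rightarrow> real^4^4 \<Rightarrow> bool" where
  "is_mat_K \<gamma> Y K \<longleftrightarrow>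
     (1/2) *\<^sub>R (mat_W \<gamma> Y + matrix_inv (mat_W \<gamma> Y)) = block4 (transpose K) 0 0 K"

definition char_multiplier :: "(real \<Rightarrow> real^8) \<Rightarrow> (real \<Rightarrow> real^8^8) \<Rightarrow> complex \<Rightarrow> bool" where
  "char_multiplier \<gamma> Y \<rho> \<longleftrightarrow> mat_eigenvalue (cmat (matrix_inv (Y0 \<gamma>) ** Y (2 * pi))) \<rho>"

definition spectrally_stable :: "(real \<Rightarrow> real^8) \<Rightarrow> (real \<Rightarrow> real^8^8) \<Rightarrow> bool" where
  "spectrally_stable \<gamma> Y \<longleftrightarrow> (\<forall>\<rho>. char_multiplier \<gamma> Y \<rho> \<longrightarrow> cmod \<rho> = 1)"

text \<open>The real subspace whose complexification is the sum of the generalized eigenspaces of \<open>W\<close>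
  for those eigenvalues \<open>\<mu>\<close> with \<open>(\<mu> + 1/\<mu>)/2 \<in> {l1, l2}\<close>.\<close>

definition stability_subspace :: "real^8^8 \<Rightarrow> complex \<Rightarrow> complex \<Rightarrow> (real^8) set" where
  "stability_subspace W l1 l2 =
     {x. cvec x \<in> vec.span (\<Union>\<mu>\<in>{\<mu>. mat_eigenvalue (cmat W) \<mu> \<and> (\<mu> + 1/\<mu>) / 2 \<in> {l1, l2}}.
            gen_eigenspace (cmat W) \<mu>)}"

definition linearly_stable ::
    "(real \<Rightarrow> real^8) \<Rightarrow> (real \<Rightarrow> real^8^8) \<Rightarrow> complex \<Rightarrow> complex \<Rightarrow> bool" where
  "linearly_stable \<gamma> Y l1 l2 \<longleftrightarrow>
     (let W = mat_W \<gamma> Y; V = stability_subspace W l1 l2 in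
        spectrally_stable \<gamma> Y \<and> dim V = 4 \<and>
        semisimple_on W V \<and> semisimple_on (W ** W ** W ** W) V)"

end

theory Submission
  imports Defs "HOL-Computational_Algebra.Fundamental_Theorem_Algebra"
begin

text \<open>The two time symmetries of \<open>\<gamma>\<close> turn solutions of the linearized system into solutions. Since the
  Hessian is symmetric, \<open>X\<^sup>T J Z\<close> is constant for any two matrix solutions \<open>X\<close>, \<open>Z\<close>; this single
  identity gives both the invertibility of \<open>Y(s)\<close> and uniqueness, hence \<open>Y\<^sub>0\<^sup>-\<^sup>1 Y(2\<pi>) = W\<^sup>4\<close>. The matrix
  \<open>Y\<^sub>0\<close> is invertible because \<open>\<gamma>'(0) \<noteq> 0\<close>: the orbit cannot pass through an equilibrium.

  As \<open>T = (W + W\<^sup>-\<^sup>1)/2\<close> is block diagonal with blocks \<open>K\<^sup>T\<close> and \<open>K\<close>, the eigenvalues of \<open>K\<close> are the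
  numbers \<open>(\<mu> + 1/\<mu>)/2\<close> for eigenvalues \<open>\<mu>\<close> of \<open>W\<close>, and \<open>\<mu>\<close> lies on the unit circle iff this number
  lies in \<open>[-1, 1]\<close>. If \<open>\<lambda>\<^sub>1 \<noteq> \<lambda>\<^sub>2\<close> lie in \<open>(-1, 1)\<close>, then \<open>K\<close> has four distinct eigenvalues, so \<open>T\<close> is
  diagonalizable with two-dimensional eigenspaces; the one for \<open>\<lambda>\<^sub>i\<close> contains eigenvectors of \<open>W\<close> for
  a nonreal \<open>\<mu>\<close> and for its conjugate, so these span it.\<close>

section \<open>Eigenvalues and characteristic polynomials\<close>

text \<open>Applying \<open>A - f k\<close> to the sum removes \<open>x k\<close> and multiplies
  every other term by \<open>f i - f k\<close>, which is nonzero by injectivity; induction does the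
  rest. The \<open>x i\<close> may vanish, so this expresses directness of the sum of
  eigenspaces.\<close>

lemma eigenvectors_sum_eq_0:
  fixes A :: "'a::field^'n^'n"
  assumes "finite I" "inj_on f I" "\<And>i. i \<in> I \<Longrightarrow> A *v x i = f i *s x i" "(\<Sum>i\<in>I. x i) = 0"
  shows "\<forall>i\<in>I. x i = 0"
  using assms
proof (induction I arbitrary: x rule: finite_induct)
  case (insert k I)
  let ?y = "\<lambda>i. (f i - f k) *s x i"
  have ev: "A *v x i = f i *s x i" if "i \<in> insert k I" for i using insert.prems that by auto
  have sum: "x k + (\<Sum>i\<in>I. x i) = 0" using insert by simp
  have "(\<Sum>i\<in>I. ?y i) = (\<Sum>i\<in>I. A *v x i) - f k *s (\<Sum>i\<in>I. x i)"
    by (simp add: ev vec.scale_left_diff_distrib sum_subtractf vec.scale_sum_right)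
  also have "(\<Sum>i\<in>I. A *v x i) = A *v (\<Sum>i\<in>I. x i)"
    by (simp add: vec.sum)
  also have "(\<Sum>i\<in>I. x i) = - x k" using sum by (metis add.inverse_unique)
  also have "A *v (- x k) - f k *s (- x k) = 0"
    by (simp add: vec.neg ev)
  finally have "(\<Sum>i\<in>I. ?y i) = 0" .
  moreover have "A *v ?y i = f i *s ?y i" if "i \<in> I" for i
    using that by (simp add: vector_scalar_commute ev vec.scale_left_diff_distrib vec.diff mult.commute)
  ultimately have "\<forall>i\<in>I. ?y i = 0"
    using insert.IH[of ?y] insert.prems by (auto simp: inj_on_def)
  hence "\<forall>i\<in>I. x i = 0" using insert by (auto simp: inj_on_def)
  with sum show ?case by simp
qed simp

lemma independent_eigenvectors:
  fixes A :: "'a::field^'n^'n"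
  assumes fin: "finite L" and b: "\<And>l. l \<in> L \<Longrightarrow> b l \<noteq> 0" "\<And>l. l \<in> L \<Longrightarrow> A *v b l = l *s b l"
  shows "inj_on b L" "vec.independent (b ` L)"
proof -
  show inj: "inj_on b L"
  proof (rule inj_onI)
    fix x y assume "x \<in> L" "y \<in> L" "b x = b y"
    hence "x *s b x = y *s b x" "b x \<noteq> 0" using b by metis+
    thus "x = y" by simp
  qed
  show "vec.independent (b ` L)"
  proof (rule vec.independent_if_scalars_zero)
    fix c x assume s: "(\<Sum>x\<in>b ` L. c x *s x) = 0" and "x \<in> b ` L"
    then obtain l where l: "l \<in> L" "x = b l" by blast
    have "(\<Sum>l\<in>L. c (b l) *s b l) = 0" using s inj by (simp add: sum.reindex)
    hence "\<forall>l\<in>L. c (b l) *s b l = 0"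
      by (intro eigenvectors_sum_eq_0[where f = id and A = A])
        (use fin b in \<open>auto simp: vector_scalar_commute mult.commute\<close>)
    thus "c x = 0" using l b by auto
  qed (use fin in auto)
qed

text \<open>Indexing the vectors by their eigenvalues fits a simple spectrum; the last clause
  records that every eigenspace is a line.\<close>

definition eigenbasis :: "'a::field^'n^'n \<Rightarrow> 'a set \<Rightarrow> ('a \<Rightarrow> 'a^'n) \<Rightarrow> bool" where
  "eigenbasis A L b \<longleftrightarrow> (\<forall>l\<in>L. A *v b l = l *s b l) \<and> (\<forall>x. \<exists>c. x = (\<Sum>l\<in>L. c l *s b l)) \<and>
     (\<forall>l\<in>L. \<forall>x. A *v x = l *s x \<longrightarrow> (\<exists>c. x = c *s b l))"

text \<open>There are as many distinct eigenvalues as dimensions, so eigenvectors, being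
  independent, already span.\<close>

lemma ex_eigenbasis:
  fixes A :: "complex^'n^'n"
  assumes L: "card L = CARD('n)" "\<And>l. l \<in> L \<Longrightarrow> mat_eigenvalue A l"
  shows "\<exists>b. eigenbasis A L b"
proof -
  from L(2) obtain b where b: "\<And>l. l \<in> L \<Longrightarrow> b l \<noteq> 0" "\<And>l. l \<in> L \<Longrightarrow> A *v b l = l *s b l"
    unfolding mat_eigenvalue_def by metis
  have fin: "finite L" using L(1) by (intro card_ge_0_finite) simp
  have inj: "inj_on b L" and indep: "vec.independent (b ` L)"
    using independent_eigenvectors[OF fin b] by auto
  have "UNIV \<subseteq> vec.span (b ` L)"
    by (rule vec.card_ge_dim_independent[OF _ indep])
      (auto simp: card_image inj L vec.dim_UNIV card_cart_basis)
  hence "x \<in> vec.span (b ` L)" for x by blast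
  hence ex: "\<exists>c. x = (\<Sum>l\<in>L. c l *s b l)" for x
  proof -
    have "x \<in> range (\<lambda>u. \<Sum>v\<in>b ` L. u v *s v)"
      using \<open>\<And>x. x \<in> vec.span (b ` L)\<close> fin by (simp add: vec.span_finite)
    thus ?thesis using inj by (auto simp: sum.reindex)
  qed
  have "\<exists>c. x = c *s b l" if l: "l \<in> L" and x: "A *v x = l *s x" for l x
  proof -
    obtain c where c: "x = (\<Sum>k\<in>L. c k *s b k)" using ex by blast
    \<comment> \<open>Moving \<open>x\<close> into the term with index \<open>l\<close> turns the
      expansion into a vanishing sum of eigenvectors for distinct eigenvalues; its
      \<open>l\<close>-th term gives \<open>x = c l *s b l\<close>.\<close>
    have "\<forall>k\<in>L. c k *s b k - (if k = l then x else 0) = 0"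
    proof (rule eigenvectors_sum_eq_0[where f = id and A = A, OF fin])
      show "(\<Sum>k\<in>L. c k *s b k - (if k = l then x else 0)) = 0"
        using fin l c by (simp add: sum_subtractf)
    qed (use b x in \<open>auto simp: vector_scalar_commute vec.diff mult.commute vec.scale_right_diff_distrib\<close>)
    with l show ?thesis by force
  qed
  with b ex show ?thesis unfolding eigenbasis_def by blast
qed

section \<open>Characteristic polynomials\<close>

lemma poly_det: "poly (det A) x = det (map_matrix (\<lambda>p. poly p x) A)"
  for A :: "'a::comm_ring_1 poly^'n^'n"
  by (simp add: det_def poly_sum poly_prod of_int_poly)

lemma poly_charpoly: "poly (charpoly A) x = det (mat x - A)"
  for A :: "'a::comm_ring_1^'n^'n"
  unfolding charpoly_def poly_det
  by (rule arg_cong[where f = det]) (simp add: vec_eq_iff mat_def)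

lemma mat_mult_vector: "mat c *v x = c *s x" for x :: "'a::comm_semiring_1^'n"
  by (simp add: vec_eq_iff matrix_vector_mult_def mat_def if_distrib[of "\<lambda>t. t * _"] cong: if_cong)

lemma mat_eigenvalue_iff_charpoly: "mat_eigenvalue A x \<longleftrightarrow> poly (charpoly A) x = 0"
proof -
  have "mat_eigenvalue A x \<longleftrightarrow> (\<exists>y. (mat x - A) *v y = 0 \<and> y \<noteq> 0)"
    by (auto simp: mat_eigenvalue_def matrix_vector_mult_diff_rdistrib mat_mult_vector) metis
  also have "\<dots> \<longleftrightarrow> \<not> invertible (mat x - A)"
    by (auto simp: invertible_left_inverse matrix_left_invertible_ker)
  finally show ?thesis by (simp add: invertible_det_nz poly_charpoly)
qed

lemma mat_eigenvalue_transpose: "mat_eigenvalue (transpose A) x \<longleftrightarrow> mat_eigenvalue A x"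
proof -
  have "mat x - transpose A = transpose (mat x - A)"
    by (simp add: vec_eq_iff transpose_def mat_def)
  thus ?thesis by (simp add: mat_eigenvalue_iff_charpoly poly_charpoly)
qed

text \<open>Dividing \<open>det (x I - A)\<close> by the \<open>n\<close>-th power of
  \<open>x\<close> gives \<open>det (I - A / x)\<close>, which tends to \<open>1\<close> at
  infinity; for a degree below \<open>n\<close> the quotient would tend to \<open>0\<close>.\<close>

lemma degree_charpoly_ge: "CARD('n) \<le> degree (charpoly A)"
  for A :: "complex^'n^'n"
proof (rule ccontr)
  assume "\<not> ?thesis"
  hence lt: "degree (charpoly A) < degree (monom 1 (CARD('n)) :: complex poly)"
    by (simp add: degree_monom_eq)
  have eq: "poly (charpoly A) x / x ^ CARD('n) = det (mat 1 - map_matrix ((*) (inverse x)) A)" if "x \<noteq> 0" for x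
  proof -
    have "mat x - A = (\<chi> i. x *s (mat 1 - map_matrix ((*) (inverse x)) A) $ i)"
      using that by (simp add: vec_eq_iff mat_def field_simps)
    hence "poly (charpoly A) x = x ^ CARD('n) * det (mat 1 - map_matrix ((*) (inverse x)) A)"
      unfolding poly_charpoly by (simp only: det_rows_mul vec_lambda_eta prod_constant)
    thus ?thesis using that by simp
  qed
  have "((\<lambda>x. det (mat 1 - map_matrix ((*) (inverse x)) A)) \<longlongrightarrow> det (mat 1 - map_matrix ((*) 0) A)) at_infinity"
    unfolding det_def map_matrix_def by (intro tendsto_intros tendsto_inverse_0)
  moreover have "eventually (\<lambda>x. x \<noteq> (0::complex)) at_infinity"
    by (rule eventually_not_equal_at_infinity)
  moreover have "map_matrix ((*) 0) A = 0" by (simp add: vec_eq_iff)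
  ultimately have "((\<lambda>x. poly (charpoly A) x / x ^ CARD('n)) \<longlongrightarrow> 1) at_infinity"
    by (subst tendsto_cong[where g = "\<lambda>x. det (mat 1 - map_matrix ((*) (inverse x)) A)"]) (auto elim: eventually_mono simp: eq)
  moreover have "((\<lambda>x. poly (charpoly A) x / x ^ CARD('n)) \<longlongrightarrow> 0) at_infinity"
    using poly_divide_tendsto_0_at_infinity[OF lt] by (simp add: poly_monom)
  ultimately show False using tendsto_unique trivial_limit_at_infinity by fastforce
qed

lemma mat_eigenvalue_iff_proots:
  fixes A :: "complex^'n^'n"
  shows "mat_eigenvalue A l \<longleftrightarrow> l \<in># proots (charpoly A)"
proof -
  \<comment> \<open>\<open>proots\<close> of the zero polynomial is empty although every number is a
    zero of it, so this case must be excluded.\<close>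
  have "charpoly A \<noteq> 0" using degree_charpoly_ge[of A] by auto
  thus ?thesis by (simp add: mat_eigenvalue_iff_charpoly)
qed


section \<open>Splitting eight coordinates\<close>

lemma UNIV_8: "UNIV = {1, 2, 3, 4, 5, 6, 7, 8::8}"
proof -
  have "x \<in> {1, 2, 3, 4, 5, 6, 7, 8}" for x :: 8
  proof (induct x)
    case (of_int z)
    then have "z = 0 \<or> z = 1 \<or> z = 2 \<or> z = 3 \<or> z = 4 \<or> z = 5 \<or> z = 6 \<or> z = 7" by fastforce
    then show ?case by auto
  qed
  thus ?thesis by blast
qed

lemma forall_8: "(\<forall>i::8. P i) \<longleftrightarrow> P 1 \<and> P 2 \<and> P 3 \<and> P 4 \<and> P 5 \<and> P 6 \<and> P 7 \<and> P 8"
  using UNIV_8 by (metis UNIV_I empty_iff insert_iff)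

lemma sum_8: "sum f (UNIV::8 set) = f 1 + f 2 + f 3 + f 4 + f 5 + f 6 + f 7 + f 8"
  unfolding UNIV_8 by (simp add: ac_simps)

lemma vector_8 [simp]:
  "(vector [x1, x2, x3, x4, x5, x6, x7, x8] :: 'a::zero^8) $ 1 = x1"
  "(vector [x1, x2, x3, x4, x5, x6, x7, x8] :: 'a::zero^8) $ 2 = x2"
  "(vector [x1, x2, x3, x4, x5, x6, x7, x8] :: 'a::zero^8) $ 3 = x3"
  "(vector [x1, x2, x3, x4, x5, x6, x7, x8] :: 'a::zero^8) $ 4 = x4"
  "(vector [x1, x2, x3, x4, x5, x6, x7, x8] :: 'a::zero^8) $ 5 = x5"
  "(vector [x1, x2, x3, x4, x5, x6, x7, x8] :: 'a::zero^8) $ 6 = x6"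
  "(vector [x1, x2, x3, x4, x5, x6, x7, x8] :: 'a::zero^8) $ 7 = x7"
  "(vector [x1, x2, x3, x4, x5, x6, x7, x8] :: 'a::zero^8) $ 8 = x8"
  by (simp_all add: vector_def)

lemma vector_4 [simp]:
  "(vector [x1, x2, x3, x4] :: 'a::zero^4) $ 1 = x1"
  "(vector [x1, x2, x3, x4] :: 'a::zero^4) $ 2 = x2"
  "(vector [x1, x2, x3, x4] :: 'a::zero^4) $ 3 = x3"
  "(vector [x1, x2, x3, x4] :: 'a::zero^4) $ 4 = x4"
  by (simp_all add: vector_def)

definition upper :: "'a::zero^8 \<Rightarrow> 'a^4" where "upper x = vector [x$1, x$2, x$3, x$4]"
definition lower :: "'a::zero^8 \<Rightarrow> 'a^4" where "lower x = vector [x$5, x$6, x$7, x$8]"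

lemma vec8_eq_iff: "x = y \<longleftrightarrow> upper x = upper y \<and> lower x = lower y"
  by (auto simp: vec_eq_iff forall_4 forall_8 upper_def lower_def)

lemma upper_lower_simps [simp]:
  "upper (0::'a^8) = 0" "lower (0::'a^8) = 0"
  "upper (c *s y) = c *s upper y" "lower (c *s y) = c *s lower y" for y :: "'a::mult_zero^8"
  by (auto simp: vec_eq_iff forall_4 upper_def lower_def)

definition join :: "'a::zero^4 \<Rightarrow> 'a^4 \<Rightarrow> 'a^8" where
  "join p q = vector [p$1, p$2, p$3, p$4, q$1, q$2, q$3, q$4]"

lemma upper_join [simp]: "upper (join p q) = p" and lower_join [simp]: "lower (join p q) = q"
  by (simp_all add: join_def upper_def lower_def vec_eq_iff forall_4)

lemma block_diag_vector_mult:
  "upper (cmat (block4 P 0 0 S) *v x) = cmat P *v upper x"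
  "lower (cmat (block4 P 0 0 S) *v x) = cmat S *v lower x"
  by (simp_all add: vec_eq_iff forall_4 upper_def lower_def matrix_vector_mult_def sum_8 sum_4 block4_def)

lemma
  fixes A :: "'a::semiring_1^'n^'n"
  assumes "invertible A"
  shows matrix_inv_left: "matrix_inv A ** A = mat 1" and matrix_inv_right: "A ** matrix_inv A = mat 1"
proof -
  have "A ** matrix_inv A = mat 1 \<and> matrix_inv A ** A = mat 1"
    using assms unfolding matrix_inv_def invertible_def by (rule someI_ex)
  thus "matrix_inv A ** A = mat 1" "A ** matrix_inv A = mat 1" by simp_all
qed

lemma cmat_mult: "cmat (A ** B) = cmat A ** cmat B"
  by (simp add: vec_eq_iff matrix_matrix_mult_def)

lemma cmat_mat: "cmat (mat c) = mat (complex_of_real c)"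
  by (simp add: vec_eq_iff mat_def)

text \<open>One half of an eigenvector is nonzero and is an eigenvector of its block; the two blocks
  share their spectrum because transposition preserves the characteristic polynomial.\<close>

lemma mat_eigenvalue_block_diag:
  "mat_eigenvalue (cmat (block4 (transpose K) 0 0 K)) l \<longleftrightarrow> mat_eigenvalue (cmat K) l" (is "?L \<longleftrightarrow> ?R")
proof -
  have t: "cmat (transpose K) = transpose (cmat K)" by (simp add: vec_eq_iff transpose_def)
  have "?L \<Longrightarrow> mat_eigenvalue (cmat (transpose K)) l \<or> ?R"
    by (auto simp: mat_eigenvalue_def vec8_eq_iff block_diag_vector_mult)
  moreover have "?R \<Longrightarrow> ?L"
  proof -
    assume ?R
    then obtain q where "q \<noteq> 0" "cmat K *v q = l *s q" by (auto simp: mat_eigenvalue_def)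
    thus ?L
      by (auto simp: mat_eigenvalue_def vec8_eq_iff block_diag_vector_mult intro!: exI[of _ "join 0 q"])
  qed
  ultimately show ?thesis by (auto simp: t mat_eigenvalue_transpose)
qed

text \<open>For a root \<open>s\<close> of \<open>r\<close>,
  \<open>A\<^sup>2 - r = (A + s) (A - s)\<close> kills \<open>x\<close>: either \<open>x\<close> is
  an eigenvector of \<open>A\<close> for \<open>s\<close>, or \<open>(A - s) x\<close> is one for
  \<open>- s\<close>. Used twice, this leads from \<open>W\<^sup>4\<close> down to
  \<open>W\<close>.\<close>

lemma mat_eigenvalue_square:
  assumes "mat_eigenvalue (A ** A) r"
  obtains s where "s\<^sup>2 = r" "mat_eigenvalue A s"
proof -
  obtain x where x: "x \<noteq> 0" "A *v (A *v x) = r *s x"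
    using assms by (auto simp: mat_eigenvalue_def matrix_vector_mul_assoc)
  define s where "s = csqrt r"
  define y where "y = A *v x - s *s x"
  have s: "s\<^sup>2 = r" by (simp add: s_def)
  have "A *v y = (- s) *s y"
    using x(2) s by (simp add: y_def vec.diff vector_scalar_commute vec_eq_iff power2_eq_square algebra_simps)
  moreover have "y = 0 \<Longrightarrow> A *v x = s *s x" by (simp add: y_def)
  ultimately have "mat_eigenvalue A (- s) \<or> mat_eigenvalue A s"
    using x(1) unfolding mat_eigenvalue_def by blast
  with s that[of s] that[of "- s"] show thesis by auto
qed

text \<open>On the unit circle \<open>1 / \<mu>\<close> is the conjugate of \<mu>, so
  \<open>l\<close> is its real part. Conversely \<mu> is a root of
  \<open>X\<^sup>2 - 2 l X + 1\<close>: if nonreal it has real part \<open>l\<close> and modulus 1,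
  if real it must be 1 or -1.\<close>

lemma unit_circle_iff:
  fixes \<mu> l :: complex
  assumes "\<mu> \<noteq> 0" "l = (\<mu> + 1 / \<mu>) / 2"
  shows "cmod \<mu> = 1 \<longleftrightarrow> l \<in> \<real> \<and> cmod l \<le> 1"
proof
  assume m: "cmod \<mu> = 1"
  hence "1 / \<mu> = cnj \<mu>" using assms(1) by (simp add: divide_conv_cnj)
  hence l: "l = complex_of_real (Re \<mu>)" using assms(2) by (simp add: complex_add_cnj)
  moreover have "\<bar>Re \<mu>\<bar> \<le> 1" using abs_Re_le_cmod[of \<mu>] m by simp
  ultimately show "l \<in> \<real> \<and> cmod l \<le> 1" by simp
next
  assume "l \<in> \<real> \<and> cmod l \<le> 1"
  then obtain t where t: "l = complex_of_real t" "\<bar>t\<bar> \<le> 1" by (auto elim!: Reals_cases)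
  define x y where "x = Re \<mu>" and "y = Im \<mu>"
  have "\<mu>\<^sup>2 + 1 = 2 * l * \<mu>" using assms by (simp add: field_simps power2_eq_square)
  hence eq: "x\<^sup>2 - y\<^sup>2 + 1 = 2 * t * x" "2 * x * y = 2 * t * y"
    unfolding x_def y_def t complex_eq_iff by (auto simp: power2_eq_square algebra_simps)
  have "x\<^sup>2 + y\<^sup>2 = 1"
  proof (cases "y = 0")
    case True
    \<comment> \<open>For real \<mu> the value \<open>x\<^sup>2 + 1 = 2 t x\<close> is at most twice
      the absolute value of \<open>x\<close>, which forces that absolute value to be 1.\<close>
    have "\<bar>t * x\<bar> \<le> 1 * \<bar>x\<bar>" unfolding abs_mult by (intro mult_right_mono t) simp
    hence "(\<bar>x\<bar> - 1)\<^sup>2 \<le> 0" using eq(1) True by (simp add: power2_diff)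
    hence "x\<^sup>2 = 1" by (simp flip: power2_abs[of x])
    thus ?thesis using True by simp
  next
    case False
    hence "x = t" using eq(2) by simp
    thus ?thesis using eq(1) by (simp add: power2_eq_square)
  qed
  thus "cmod \<mu> = 1" by (simp add: cmod_def x_def y_def)
qed

section \<open>Complexification of real subspaces\<close>

lemma cvec_in_vec_span: "x \<in> span S \<Longrightarrow> cvec x \<in> vec.span (cvec ` S)"
proof (induction rule: span_induct_alt)
  case (step c x y)
  have "cvec (c *\<^sub>R x + y) = complex_of_real c *s cvec x + cvec y" by (simp add: vec_eq_iff)
  with step show ?case by (auto intro: vec.span_add vec.span_scale vec.span_base)
qed (simp add: vec.span_zero flip: zero_vec_def)

text \<open>Real and imaginary parts of the coefficients split a complex relation among real vectors
  into two real relations.\<close>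

lemma vec_independent_cvec:
  assumes "independent S"
  shows "vec.independent (cvec ` S)"
proof (rule vec.independent_if_scalars_zero)
  have inj: "inj_on cvec S" by (auto simp: inj_on_def vec_eq_iff)
  show "finite (cvec ` S)" using assms by (simp add: finiteI_independent)
  fix f x assume "(\<Sum>x\<in>cvec ` S. f x *s x) = 0" and x: "x \<in> cvec ` S"
  hence s: "(\<Sum>x\<in>S. f (cvec x) *s cvec x) = 0" using inj by (simp add: sum.reindex)
  have "(\<Sum>x\<in>S. Re (f (cvec x)) *\<^sub>R x) = 0" "(\<Sum>x\<in>S. Im (f (cvec x)) *\<^sub>R x) = 0"
    using s by (auto simp: vec_eq_iff complex_eq_iff)
  hence "Re (f (cvec x)) = 0 \<and> Im (f (cvec x)) = 0" if "x \<in> S" for x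
    using that independentD[OF assms finiteI_independent[OF assms] subset_refl,
        where u = "\<lambda>x. Re (f (cvec x))"]
      independentD[OF assms finiteI_independent[OF assms] subset_refl,
        where u = "\<lambda>x. Im (f (cvec x))"] by blast
  thus "f x = 0" using x by (auto simp: complex_eq_iff)
qed

text \<open>A real basis stays a basis after complexification, so \<open>dim V\<close> can be
  counted with complex eigenvectors.\<close>

lemma dim_eq_vec_dim_cvec: "dim V = vec.dim (cvec ` V)"
proof -
  obtain B where B: "B \<subseteq> V" "independent B" "V \<subseteq> span B" "card B = dim V"
    using basis_exists by blast
  have "vec.dim (cvec ` V) = card (cvec ` B)"
    using B cvec_in_vec_span by (intro vec.dim_unique[OF _ _ vec_independent_cvec refl]) auto
  also have "\<dots> = card B" by (rule card_image) (auto simp: inj_on_def vec_eq_iff)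
  finally show ?thesis using B by simp
qed


section \<open>Matrices with block diagonal mean of \<open>W\<close> and \<open>W\<^sup>-\<^sup>1\<close>\<close>

locale block_diagonal_mean =
  fixes W :: "real^8^8" and K :: "real^4^4"
  assumes invertible_W: "invertible W"
    and sum_inverse: "(1/2) *\<^sub>R (W + matrix_inv W) = block4 (transpose K) 0 0 K"
begin

abbreviation T :: "complex^8^8" where "T \<equiv> cmat (block4 (transpose K) 0 0 K)"

lemma T_apply: "T *v x = (1/2) *s (cmat W *v x + cmat (matrix_inv W) *v x)"
  unfolding sum_inverse[symmetric]
  by (simp add: vec_eq_iff matrix_vector_mult_def sum_distrib_left algebra_simps flip: sum.distrib)

lemma W_inverse:
  "cmat (matrix_inv W) *v (cmat W *v x) = x" "cmat W *v (cmat (matrix_inv W) *v x) = x"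
  using matrix_inv_left[OF invertible_W] matrix_inv_right[OF invertible_W]
  by (simp_all add: matrix_vector_mul_assoc cmat_mat flip: cmat_mult)

text \<open>Together with \<open>T_W\<close> this shows that \<open>W\<close> and \<open>T\<close>
  commute, and that \<open>W\<^sup>2 = 2 T W - 1\<close>.\<close>

lemma W_T: "cmat W *v (T *v x) = (1/2) *s (cmat W *v (cmat W *v x) + x)"
  by (simp only: T_apply vector_scalar_commute vec.add W_inverse)

lemma T_W: "T *v (cmat W *v x) = (1/2) *s (cmat W *v (cmat W *v x) + x)"
  by (simp only: T_apply W_inverse)

lemma W_eq_0: "cmat W *v x = 0 \<Longrightarrow> x = 0"
  by (metis W_inverse(1) matrix_vector_mult_0_right)

lemma eigenvalue_W_nonzero: "mat_eigenvalue (cmat W) \<mu> \<Longrightarrow> \<mu> \<noteq> 0"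
  using W_eq_0 by (auto simp: mat_eigenvalue_def)

lemma T_eigenvector:
  assumes "cmat W *v x = \<mu> *s x" "\<mu> \<noteq> 0"
  shows "T *v x = ((\<mu> + 1 / \<mu>) / 2) *s x"
proof -
  have "\<mu> *s (T *v x) = T *v (cmat W *v x)" using assms(1) by (simp add: vector_scalar_commute)
  also have "\<dots> = (1/2) *s (\<mu> *s (\<mu> *s x) + x)"
    by (simp only: T_W) (simp only: assms(1) vector_scalar_commute)
  also have "\<dots> = ((\<mu>\<^sup>2 + 1) / 2) *s x"
    by (simp add: vec_eq_iff power2_eq_square algebra_simps add_divide_distrib)
  finally have "(1 / \<mu>) *s (\<mu> *s (T *v x)) = (1 / \<mu>) *s (((\<mu>\<^sup>2 + 1) / 2) *s x)" by simp
  moreover have "1 / \<mu> * ((\<mu>\<^sup>2 + 1) / 2) = (\<mu> + 1 / \<mu>) / 2"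
    using assms(2) by (simp add: power2_eq_square field_simps)
  ultimately show ?thesis using assms(2) by simp
qed

text \<open>On an eigenvector \<open>x\<close> of \<open>T\<close> for \<open>l\<close>, the
  polynomial \<open>W\<^sup>2 - 2 l W + 1\<close> vanishes. It factors as
  \<open>(W - \<mu>) (W - \<nu>)\<close>, so either \<open>(W - \<nu>) x\<close> is an eigenvector
  for \<mu>, or \<open>x\<close> is one for \<nu>.\<close>

lemma W_eigenvector:
  assumes "T *v x = l *s x" "x \<noteq> 0"
  obtains \<mu> where "mat_eigenvalue (cmat W) \<mu>" "l = (\<mu> + 1 / \<mu>) / 2"
proof -
  \<comment> \<open>The roots of \<open>X\<^sup>2 - 2 l X + 1\<close>. Their product is 1, so they
    are inverse to each other and either one serves as the witness.\<close>
  define \<mu> where "\<mu> = l + csqrt (l\<^sup>2 - 1)"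
  define \<nu> where "\<nu> = l - csqrt (l\<^sup>2 - 1)"
  have "\<mu> * \<nu> = l\<^sup>2 - (csqrt (l\<^sup>2 - 1))\<^sup>2"
    unfolding \<mu>_def \<nu>_def power2_eq_square by (simp add: algebra_simps)
  hence prod: "\<mu> * \<nu> = 1" by simp
  have sum: "\<mu> + \<nu> = 2 * l" by (simp add: \<mu>_def \<nu>_def)
  have "1 / \<mu> = \<nu>" "1 / \<nu> = \<mu>"
    using prod by (metis divide_eq_eq mult.commute mult_zero_left zero_neq_one)+
  hence l: "l = (\<mu> + 1 / \<mu>) / 2" "l = (\<nu> + 1 / \<nu>) / 2"
    using sum by (simp_all add: mult.commute[of l] add.commute[of \<nu>])
  define y where "y = cmat W *v x - \<nu> *s x"
  have "cmat W *v (cmat W *v x) + x = 2 *s (cmat W *v (T *v x))" by (simp only: W_T) simp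
  also have "\<dots> = (\<mu> + \<nu>) *s (cmat W *v x)" by (simp only: assms(1) vector_scalar_commute sum) simp
  finally have WW: "cmat W *v (cmat W *v x) = (\<mu> + \<nu>) *s (cmat W *v x) - x" by (simp add: eq_diff_eq)
  have "cmat W *v y = cmat W *v (cmat W *v x) - \<nu> *s (cmat W *v x)"
    by (simp only: y_def vec.diff vector_scalar_commute)
  also have "\<dots> = \<mu> *s (cmat W *v x) - (\<mu> * \<nu>) *s x"
    by (simp only: WW prod vec.scale_left_distrib) simp
  also have "\<dots> = \<mu> *s y" by (simp add: y_def vec.scale_right_diff_distrib)
  finally have "cmat W *v y = \<mu> *s y" .
  moreover have "y = 0 \<Longrightarrow> cmat W *v x = \<nu> *s x" by (simp add: y_def)
  ultimately have "mat_eigenvalue (cmat W) \<mu> \<or> mat_eigenvalue (cmat W) \<nu>"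
    using assms(2) unfolding mat_eigenvalue_def by blast
  with l that show thesis by blast
qed

lemma eigenvalue_K_iff:
  "mat_eigenvalue (cmat K) l \<longleftrightarrow> (\<exists>\<mu>. mat_eigenvalue (cmat W) \<mu> \<and> l = (\<mu> + 1 / \<mu>) / 2)"
proof
  assume "mat_eigenvalue (cmat K) l"
  hence "mat_eigenvalue T l" by (simp only: mat_eigenvalue_block_diag)
  then obtain x where "x \<noteq> 0" "T *v x = l *s x" unfolding mat_eigenvalue_def by blast
  then show "\<exists>\<mu>. mat_eigenvalue (cmat W) \<mu> \<and> l = (\<mu> + 1 / \<mu>) / 2" by (blast elim: W_eigenvector)
next
  assume "\<exists>\<mu>. mat_eigenvalue (cmat W) \<mu> \<and> l = (\<mu> + 1 / \<mu>) / 2"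
  then obtain \<mu> x where x: "x \<noteq> 0" "cmat W *v x = \<mu> *s x" and \<mu>: "\<mu> \<noteq> 0" "l = (\<mu> + 1 / \<mu>) / 2"
    using eigenvalue_W_nonzero unfolding mat_eigenvalue_def by blast
  from x T_eigenvector[OF x(2) \<mu>(1)] have "mat_eigenvalue T l" unfolding mat_eigenvalue_def \<mu>(2) by blast
  thus "mat_eigenvalue (cmat K) l" by (simp only: mat_eigenvalue_block_diag)
qed

lemma eigenvalue_W4_unit_iff:
  "(\<forall>\<rho>. mat_eigenvalue (cmat (W ** W ** W ** W)) \<rho> \<longrightarrow> cmod \<rho> = 1) \<longleftrightarrow>
   (\<forall>l. mat_eigenvalue (cmat K) l \<longrightarrow> l \<in> \<real> \<and> cmod l \<le> 1)"
proof -
  \<comment> \<open>The fourth power is bracketed as the square of a square, ready for two uses of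
    \<open>mat_eigenvalue_square\<close>.\<close>
  have W4: "cmat (W ** W ** W ** W) = (cmat W ** cmat W) ** (cmat W ** cmat W)"
    by (simp add: cmat_mult matrix_mul_assoc)
  have "(\<forall>\<rho>. mat_eigenvalue (cmat (W ** W ** W ** W)) \<rho> \<longrightarrow> cmod \<rho> = 1) \<longleftrightarrow>
        (\<forall>\<mu>. mat_eigenvalue (cmat W) \<mu> \<longrightarrow> cmod \<mu> = 1)" (is "?L \<longleftrightarrow> ?R")
  proof safe
    fix \<mu> assume L: ?L and "mat_eigenvalue (cmat W) \<mu>"
    then obtain x where "x \<noteq> 0" "cmat W *v x = \<mu> *s x" by (auto simp: mat_eigenvalue_def)
    hence "mat_eigenvalue (cmat (W ** W ** W ** W)) (\<mu> ^ 4)"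
      unfolding W4 mat_eigenvalue_def
      by (intro exI[of _ x]) (simp add: vector_scalar_commute power4_eq_xxxx mult.assoc flip: matrix_vector_mul_assoc)
    with L have "cmod \<mu> ^ 4 = 1" by (metis norm_power)
    thus "cmod \<mu> = 1" using power_eq_imp_eq_base[of "cmod \<mu>" 4 1] by simp
  next
    fix \<rho> assume R: ?R and "mat_eigenvalue (cmat (W ** W ** W ** W)) \<rho>"
    then obtain s where s: "s\<^sup>2 = \<rho>" "mat_eigenvalue (cmat W ** cmat W) s"
      unfolding W4 by (blast elim: mat_eigenvalue_square)
    from s(2) obtain t where "t\<^sup>2 = s" "mat_eigenvalue (cmat W) t"
      by (blast elim: mat_eigenvalue_square)
    note s this
    with R show "cmod \<rho> = 1" by (auto simp: norm_power)
  qed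
  also have "\<dots> \<longleftrightarrow> (\<forall>\<mu>. mat_eigenvalue (cmat W) \<mu> \<longrightarrow> (\<mu> + 1 / \<mu>) / 2 \<in> \<real> \<and> cmod ((\<mu> + 1 / \<mu>) / 2) \<le> 1)"
    using unit_circle_iff eigenvalue_W_nonzero by blast
  also have "\<dots> \<longleftrightarrow> (\<forall>l. mat_eigenvalue (cmat K) l \<longrightarrow> l \<in> \<real> \<and> cmod l \<le> 1)"
    unfolding eigenvalue_K_iff by blast
  finally show ?thesis .
qed

end

section \<open>Complex subspaces closed under conjugation\<close>

lemma span_cvec_real_points:
  assumes E: "vec.subspace E" and conj: "\<And>y. y \<in> E \<Longrightarrow> (\<chi> i. cnj (y $ i)) \<in> E"
  shows "vec.span (cvec ` {x. cvec x \<in> E}) = E"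
proof
  show "vec.span (cvec ` {x. cvec x \<in> E}) \<subseteq> E"
    using E by (intro vec.span_minimal) auto
  show "E \<subseteq> vec.span (cvec ` {x. cvec x \<in> E})"
  proof
    fix y assume y: "y \<in> E"
    define a b where "a = (\<chi> i. Re (y $ i))" and "b = (\<chi> i. Im (y $ i))"
    \<comment> \<open>Real and imaginary parts are combinations of \<open>y\<close> and its
      conjugate, hence lie in \<open>E\<close> and are real points of it.\<close>
    have "cvec a = (1/2) *s (y + (\<chi> i. cnj (y $ i)))" "cvec b = (1/(2*\<i>)) *s (y - (\<chi> i. cnj (y $ i)))"
      by (simp_all add: a_def b_def vec_eq_iff complex_eq_iff)
    hence "cvec a \<in> E" "cvec b \<in> E"
      using E conj[OF y] y by (auto intro: vec.subspace_add vec.subspace_diff vec.subspace_scale)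
    moreover have "y = cvec a + \<i> *s cvec b"
      by (simp add: a_def b_def vec_eq_iff complex_eq_iff)
    ultimately show "y \<in> vec.span (cvec ` {x. cvec x \<in> E})"
      by (metis (mono_tags, lifting) image_eqI mem_Collect_eq vec.span_add vec.span_base vec.span_scale)
  qed
qed

lemma cmat_mult_cnj: "cmat A *v (\<chi> i. cnj (x $ i)) = (\<chi> i. cnj ((cmat A *v x) $ i))"
  by (simp add: vec_eq_iff matrix_vector_mult_def)

lemma mat_eigenvalue_cnj:
  assumes "mat_eigenvalue (cmat A) \<mu>"
  shows "mat_eigenvalue (cmat A) (cnj \<mu>)"
proof -
  obtain x where "x \<noteq> 0" "cmat A *v x = \<mu> *s x" using assms by (auto simp: mat_eigenvalue_def)
  moreover from this have "(\<chi> i. cnj (x $ i)) \<noteq> 0" by (auto simp: vec_eq_iff)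
  ultimately show ?thesis unfolding mat_eigenvalue_def
    by (intro exI[of _ "\<chi> i. cnj (x $ i)"]) (simp add: cmat_mult_cnj vec_eq_iff)
qed

lemma
  fixes x y :: "'a::comm_monoid_add^8"
  shows upper_add: "upper (x + y) = upper x + upper y" and lower_add: "lower (x + y) = lower x + lower y"
  by (simp_all add: vec_eq_iff forall_4 upper_def lower_def)

lemma
  fixes f :: "_ \<Rightarrow> 'a::comm_monoid_add^8"
  shows upper_sum: "upper (sum f I) = (\<Sum>i\<in>I. upper (f i))"
    and lower_sum: "lower (sum f I) = (\<Sum>i\<in>I. lower (f i))"
  by (simp_all add: vec_eq_iff forall_4 upper_def lower_def)

section \<open>Four distinct eigenvalues of \<open>K\<close>\<close>

locale simple_block_diagonal_mean = block_diagonal_mean +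
  fixes l1 l2 :: complex
  assumes ev_minus_1: "mat_eigenvalue (cmat K) (-1)"
    and proots_K: "proots (charpoly (cmat K)) - {#1, -1#} = {#l1, l2#}"
    and real: "l1 \<in> \<real>" "l2 \<in> \<real>" and distinct: "l1 \<noteq> l2" and less_1: "cmod l1 < 1" "cmod l2 < 1"
begin

abbreviation L :: "complex set" where "L \<equiv> {1, -1, l1, l2}"

lemma card_L: "card L = 4"
proof -
  have "l1 \<noteq> 1" "l1 \<noteq> -1" "l2 \<noteq> 1" "l2 \<noteq> -1" using less_1 by auto
  thus ?thesis using distinct by (simp add: card_insert_if)
qed

lemma eigenvalue_L:
  assumes "l \<in> L"
  shows "mat_eigenvalue (cmat K) l"
proof -
  let ?p = "charpoly (cmat K)"
  have deg: "4 \<le> degree ?p" using degree_charpoly_ge[of "cmat K"] by simp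
  note iff = mat_eigenvalue_iff_proots[of "cmat K"]
  \<comment> \<open>Multiset difference ignores absent elements. Were 1 not a root, only -1 would be
    removed, and at least three roots would remain instead of two.\<close>
  have "1 \<in># proots ?p"
  proof (rule ccontr)
    assume "1 \<notin># proots ?p"
    hence "proots ?p - {#1, -1#} = proots ?p - {#-1#}" by (simp add: diff_single_trivial)
    hence "size (proots ?p - {#-1#}) = size {#l1, l2#}" using proots_K by simp
    moreover have "size (proots ?p - {#-1#}) = size (proots ?p) - 1"
      using ev_minus_1 iff by (simp add: size_Diff_singleton)
    ultimately show False using deg by (simp add: size_proots_complex)
  qed
  moreover have "l1 \<in># proots ?p" "l2 \<in># proots ?p"
    using proots_K in_diffD[of l1 "proots ?p" "{#1, -1#}"] in_diffD[of l2 "proots ?p" "{#1, -1#}"] by auto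
  ultimately show ?thesis using assms ev_minus_1 iff by auto
qed

lemma eigenspace_bases:
  obtains b b' where "eigenbasis (cmat K) L b" "eigenbasis (cmat (transpose K)) L b'"
proof -
  have t: "cmat (transpose K) = transpose (cmat K)" by (simp add: vec_eq_iff transpose_def)
  have card: "card L = CARD(4)" using card_L by simp
  have ev: "mat_eigenvalue (cmat (transpose K)) l" if "l \<in> L" for l
    using eigenvalue_L[OF that] by (simp only: t mat_eigenvalue_transpose)
  show thesis using ex_eigenbasis[OF card eigenvalue_L] ex_eigenbasis[OF card ev] that by blast
qed

text \<open>The two halves of \<open>x\<close> are expanded separately in eigenvectors of the
  blocks, and components with equal eigenvalue are joined.\<close>

lemma T_decomposition:
  obtains y where "x = (\<Sum>l\<in>L. y l)" "\<And>l. l \<in> L \<Longrightarrow> T *v y l = l *s y l"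
proof -
  obtain b b' where b: "eigenbasis (cmat K) L b" "eigenbasis (cmat (transpose K)) L b'"
    by (rule eigenspace_bases)
  from b(2) obtain c' where c': "upper x = (\<Sum>l\<in>L. c' l *s b' l)" unfolding eigenbasis_def by blast
  from b(1) obtain c where c: "lower x = (\<Sum>l\<in>L. c l *s b l)" unfolding eigenbasis_def by blast
  show thesis
  proof
    show "x = (\<Sum>l\<in>L. join (c' l *s b' l) (c l *s b l))"
      unfolding vec8_eq_iff upper_sum lower_sum c c' upper_join lower_join by (rule conjI refl)+
    fix l assume l: "l \<in> L"
    have "cmat K *v b l = l *s b l" "cmat (transpose K) *v b' l = l *s b' l"
      using b l unfolding eigenbasis_def by blast+
    thus "T *v join (c' l *s b' l) (c l *s b l) = l *s join (c' l *s b' l) (c l *s b l)"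
      by (simp add: vec8_eq_iff block_diag_vector_mult vector_scalar_commute mult.commute)
  qed
qed

text \<open>Each of the two blocks has simple spectrum and contributes one line to the
  eigenspace.\<close>

lemma dim_T_eigenspace:
  assumes "l \<in> L"
  shows "vec.dim {x. T *v x = l *s x} \<le> 2"
proof -
  obtain b b' where b: "eigenbasis (cmat K) L b" "eigenbasis (cmat (transpose K)) L b'"
    by (rule eigenspace_bases)
  define p q where "p = join (b' l) 0" and "q = join 0 (b l)"
  have p: "upper p = b' l" "lower p = 0" and q: "upper q = 0" "lower q = b l"
    by (simp_all add: p_def q_def)
  have "x \<in> vec.span {p, q}" if "T *v x = l *s x" for x
  proof -
    have "cmat (transpose K) *v upper x = l *s upper x" "cmat K *v lower x = l *s lower x"
      using that by (auto simp: vec8_eq_iff block_diag_vector_mult)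
    then obtain c d where "upper x = c *s b' l" "lower x = d *s b l"
      using b assms unfolding eigenbasis_def by blast
    hence "x = c *s p + d *s q"
      by (simp add: vec8_eq_iff upper_add lower_add p q)
    thus ?thesis by (auto intro: vec.span_add vec.span_scale vec.span_base)
  qed
  hence "vec.dim {x. T *v x = l *s x} \<le> card {p, q}"
    by (intro vec.dim_le_card) auto
  also have "\<dots> \<le> 2" by (simp add: card_insert_le_m1)
  finally show ?thesis .
qed

text \<open>As \<open>W\<close> commutes with \<open>T\<close>, powers of \<open>W - \<mu>\<close>
  preserve the eigenspaces of \<open>T\<close>. On the eigenspace for an \<open>l\<close> other than
  \<open>(\<mu> + 1 / \<mu>) / 2\<close> they are injective, since a kernel vector of
  \<open>W - \<mu>\<close> belongs to that other eigenvalue of \<open>T\<close>.\<close>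

lemma T_funpow:
  defines "N \<equiv> \<lambda>\<mu> y. (cmat W - mat \<mu>) *v y"
  shows "T *v y = l *s y \<Longrightarrow> T *v ((N \<mu> ^^ k) y) = l *s ((N \<mu> ^^ k) y)"
    and "T *v y = l *s y \<Longrightarrow> (N \<mu> ^^ k) y = 0 \<Longrightarrow> \<mu> \<noteq> 0 \<Longrightarrow> l \<noteq> (\<mu> + 1 / \<mu>) / 2 \<Longrightarrow> y = 0"
    and "(N \<mu> ^^ k) (sum f I) = (\<Sum>i\<in>I. (N \<mu> ^^ k) (f i))"
proof -
  have N: "N \<mu> y = cmat W *v y - \<mu> *s y" for y
    by (simp add: N_def matrix_vector_mult_diff_rdistrib mat_mult_vector)
  have 1: "T *v N \<mu> y = l *s N \<mu> y" if "T *v y = l *s y" for y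
  proof -
    have "T *v (cmat W *v y) = cmat W *v (T *v y)" by (simp only: T_W W_T)
    thus ?thesis using that
      by (simp add: N vec.diff vector_scalar_commute vec.scale_right_diff_distrib mult.commute)
  qed
  show "T *v y = l *s y \<Longrightarrow> T *v ((N \<mu> ^^ k) y) = l *s ((N \<mu> ^^ k) y)"
    by (induction k) (auto intro: 1)
  show "T *v y = l *s y \<Longrightarrow> (N \<mu> ^^ k) y = 0 \<Longrightarrow> \<mu> \<noteq> 0 \<Longrightarrow> l \<noteq> (\<mu> + 1 / \<mu>) / 2 \<Longrightarrow> y = 0"
  proof (induction k arbitrary: y)
    case (Suc k)
    hence "N \<mu> y = 0" using 1[of y] by (simp add: funpow_swap1)
    hence "cmat W *v y = \<mu> *s y" by (simp add: N)
    from T_eigenvector[OF this] Suc.prems have "((\<mu> + 1 / \<mu>) / 2 - l) *s y = 0"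
      by (simp add: vec.scale_left_diff_distrib)
    with Suc.prems show ?case by simp
  qed simp
  show "(N \<mu> ^^ k) (sum f I) = (\<Sum>i\<in>I. (N \<mu> ^^ k) (f i))"
    by (induction k) (auto simp: N_def vec.sum)
qed

text \<open>Split \<open>x\<close> along the eigenspaces of \<open>T\<close>. A power of
  \<open>W - \<mu>\<close> killing \<open>x\<close> kills each component, and by injectivity only
  the component for \<open>(\<mu> + 1 / \<mu>) / 2\<close> can survive.\<close>

lemma gen_eigenspace_subset:
  assumes \<mu>: "\<mu> \<noteq> 0" and "(\<mu> + 1 / \<mu>) / 2 \<in> L"
  shows "gen_eigenspace (cmat W) \<mu> \<subseteq> {x. T *v x = ((\<mu> + 1 / \<mu>) / 2) *s x}"
proof safe
  let ?l = "(\<mu> + 1 / \<mu>) / 2" and ?N = "\<lambda>y. (cmat W - mat \<mu>) *v y"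
  fix x assume "x \<in> gen_eigenspace (cmat W) \<mu>"
  then obtain k where k: "(?N ^^ k) x = 0" by (auto simp: gen_eigenspace_def)
  obtain y where x: "x = (\<Sum>l\<in>L. y l)" and y: "\<And>l. l \<in> L \<Longrightarrow> T *v y l = l *s y l"
    using T_decomposition by blast
  have "\<forall>l\<in>L. (?N ^^ k) (y l) = 0"
    by (rule eigenvectors_sum_eq_0[where f = id and A = T])
      (use k x T_funpow(1)[OF y] in \<open>auto simp flip: T_funpow(3)\<close>)
  hence "y l = 0" if "l \<in> L" "l \<noteq> ?l" for l
    using T_funpow(2)[OF y] that \<mu> by blast
  hence "x = (\<Sum>l\<in>L. if l = ?l then y l else 0)" unfolding x by (intro sum.cong) auto
  also have "\<dots> = y ?l" using assms(2) by (subst sum.delta) auto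
  finally show "T *v x = ?l *s x" using y assms(2) by blast
qed

text \<open>\<mu> has modulus 1; if it were real it would be 1 or -1, and so would \<open>l\<close>,
  against \<open>cmod l < 1\<close>.\<close>

lemma nonreal_eigenvalue:
  assumes "l \<in> {l1, l2}"
  obtains \<mu> where "mat_eigenvalue (cmat W) \<mu>" "l = (\<mu> + 1 / \<mu>) / 2" "cnj \<mu> \<noteq> \<mu>"
proof -
  have l: "l \<in> \<real>" "cmod l < 1" "l \<in> L" using assms real less_1 by auto
  obtain \<mu> where \<mu>: "mat_eigenvalue (cmat W) \<mu>" "l = (\<mu> + 1 / \<mu>) / 2"
    using eigenvalue_L[OF l(3)] eigenvalue_K_iff by blast
  have "cmod \<mu> = 1" using unit_circle_iff[OF eigenvalue_W_nonzero[OF \<mu>(1)] \<mu>(2)] l by simp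
  have "cnj \<mu> \<noteq> \<mu>"
  proof
    assume "cnj \<mu> = \<mu>"
    hence "\<mu> * \<mu> = 1" using \<open>cmod \<mu> = 1\<close> by (metis complex_norm_square of_real_1 power_one)
    hence "\<mu> = 1 \<or> \<mu> = -1" by (simp add: square_eq_1_iff)
    with \<mu>(2) l(2) show False by auto
  qed
  with \<mu> that show thesis by blast
qed

theorem linear_stability:
  defines "V \<equiv> stability_subspace W l1 l2"
  shows "dim V = 4" "semisimple_on W V" "semisimple_on (W ** W ** W ** W) V"
proof -
  let ?l = "\<lambda>\<mu>. (\<mu> + 1 / \<mu>) / 2"
  define E where "E = vec.span (\<Union>\<mu>\<in>{\<mu>. mat_eigenvalue (cmat W) \<mu> \<and> ?l \<mu> \<in> {l1, l2}}.
            gen_eigenspace (cmat W) \<mu>)"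
  obtain \<mu>1 where \<mu>1: "mat_eigenvalue (cmat W) \<mu>1" "l1 = ?l \<mu>1" "cnj \<mu>1 \<noteq> \<mu>1"
    using nonreal_eigenvalue[of l1] by blast
  obtain \<mu>2 where \<mu>2: "mat_eigenvalue (cmat W) \<mu>2" "l2 = ?l \<mu>2" "cnj \<mu>2 \<noteq> \<mu>2"
    using nonreal_eigenvalue[of l2] by blast
  have cnj_l: "?l (cnj \<mu>) = cnj (?l \<mu>)" for \<mu> by simp
  have cnj_l1: "?l (cnj \<mu>1) = l1" and cnj_l2: "?l (cnj \<mu>2) = l2"
    unfolding cnj_l \<mu>1(2)[symmetric] \<mu>2(2)[symmetric] using real by (simp_all add: Reals_cnj_iff)
  \<comment> \<open>These are four distinct numbers: within a pair because they are nonreal, across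
    pairs because they lead to \<open>l1\<close> and \<open>l2\<close> respectively.\<close>
  define M where "M = {\<mu>1, cnj \<mu>1, \<mu>2, cnj \<mu>2}"
  have "\<forall>\<mu>\<in>M. mat_eigenvalue (cmat W) \<mu>"
    using \<mu>1 \<mu>2 mat_eigenvalue_cnj by (auto simp: M_def)
  then obtain b where b: "\<And>\<mu>. \<mu> \<in> M \<Longrightarrow> b \<mu> \<noteq> 0" "\<And>\<mu>. \<mu> \<in> M \<Longrightarrow> cmat W *v b \<mu> = \<mu> *s b \<mu>"
    unfolding mat_eigenvalue_def by metis
  have M: "\<mu> \<noteq> 0 \<and> ?l \<mu> \<in> {l1, l2}" if "\<mu> \<in> M" for \<mu>
  proof -
    have "\<mu>1 \<noteq> 0" "\<mu>2 \<noteq> 0" using \<mu>1 \<mu>2 eigenvalue_W_nonzero by blast+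
    moreover have "?l \<mu>1 \<in> {l1, l2}" "?l (cnj \<mu>1) \<in> {l1, l2}" "?l \<mu>2 \<in> {l1, l2}" "?l (cnj \<mu>2) \<in> {l1, l2}"
      by (simp_all only: \<mu>1(2)[symmetric] \<mu>2(2)[symmetric] cnj_l1 cnj_l2) simp_all
    moreover have "\<mu> = \<mu>1 \<or> \<mu> = cnj \<mu>1 \<or> \<mu> = \<mu>2 \<or> \<mu> = cnj \<mu>2" using that by (simp add: M_def)
    ultimately show ?thesis by (elim disjE) (simp_all only: complex_cnj_zero_iff, simp_all)
  qed
  have T_b: "T *v b \<mu> = ?l \<mu> *s b \<mu>" if "\<mu> \<in> M" for \<mu>
    using T_eigenvector b(2) M that by blast
  have "\<mu>1 \<noteq> \<mu>2" "\<mu>1 \<noteq> cnj \<mu>2" "cnj \<mu>1 \<noteq> \<mu>2" "cnj \<mu>1 \<noteq> cnj \<mu>2"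
    using distinct \<mu>1(2) \<mu>2(2) cnj_l1 cnj_l2 by metis+
  hence card_M: "card M = 4" using \<mu>1(3) \<mu>2(3) by (simp add: M_def card_insert_if)
  have fin_M: "finite M" by (simp add: M_def)
  let ?X = "b ` M"
  note inj = independent_eigenvectors(1)[OF fin_M b] and indep = independent_eigenvectors(2)[OF fin_M b]
  have T_eigenspace: "{x. T *v x = l *s x} \<subseteq> vec.span ?X" if "l \<in> {l1, l2}" for l
  proof -
    obtain \<mu> where \<mu>: "\<mu> \<in> M" "cnj \<mu> \<in> M" "cnj \<mu> \<noteq> \<mu>" "?l \<mu> = l" "?l (cnj \<mu>) = l"
    proof (cases "l = l1")
      case True
      show thesis by (rule that[of \<mu>1]) (use True \<mu>1 cnj_l1 in \<open>simp_all add: M_def\<close>)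
    next
      case False
      hence "l = l2" using \<open>l \<in> {l1, l2}\<close> by simp
      show thesis by (rule that[of \<mu>2]) (use \<open>l = l2\<close> \<mu>2 cnj_l2 in \<open>simp_all add: M_def\<close>)
    qed
    \<comment> \<open>Two independent vectors in a space of dimension at most two span it.\<close>
    have "{x. T *v x = l *s x} \<subseteq> vec.span {b \<mu>, b (cnj \<mu>)}"
    proof (rule vec.card_ge_dim_independent)
      show "{b \<mu>, b (cnj \<mu>)} \<subseteq> {x. T *v x = l *s x}"
        using T_b[OF \<mu>(1)] T_b[OF \<mu>(2)] unfolding \<mu>(4,5) by blast
      show "vec.independent {b \<mu>, b (cnj \<mu>)}"
        using \<mu>(1,2) by (intro vec.independent_mono[OF indep]) auto
      have "b \<mu> \<noteq> b (cnj \<mu>)" using inj \<mu> by (metis inj_onD)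
      thus "vec.dim {x. T *v x = l *s x} \<le> card {b \<mu>, b (cnj \<mu>)}"
        using dim_T_eigenspace[of l] that by auto
    qed
    also have "\<dots> \<subseteq> vec.span ?X" using \<mu>(1,2) by (intro vec.span_mono) simp
    finally show ?thesis .
  qed
  have E: "E = vec.span ?X"
  proof
    show "E \<subseteq> vec.span ?X" unfolding E_def
    proof (intro vec.span_minimal vec.subspace_span UN_least)
      fix \<mu> assume "\<mu> \<in> {\<mu>. mat_eigenvalue (cmat W) \<mu> \<and> ?l \<mu> \<in> {l1, l2}}"
      hence "\<mu> \<noteq> 0" "?l \<mu> \<in> {l1, l2}" using eigenvalue_W_nonzero by blast+
      thus "gen_eigenspace (cmat W) \<mu> \<subseteq> vec.span ?X"
        using gen_eigenspace_subset[of \<mu>] T_eigenspace[of "?l \<mu>"] by blast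
    qed
    show "vec.span ?X \<subseteq> E" unfolding E_def
    proof (intro vec.span_mono subsetI, elim imageE)
      fix x \<mu> assume x: "x = b \<mu>" and \<mu>: "\<mu> \<in> M"
      have "((\<lambda>y. (cmat W - mat \<mu>) *v y) ^^ 1) x = 0"
        using b(2)[OF \<mu>] by (simp add: x matrix_vector_mult_diff_rdistrib mat_mult_vector)
      hence "x \<in> gen_eigenspace (cmat W) \<mu>" unfolding gen_eigenspace_def by blast
      moreover have "mat_eigenvalue (cmat W) \<mu>" using b \<mu> unfolding mat_eigenvalue_def by blast
      ultimately show "x \<in> (\<Union>\<mu>\<in>{\<mu>. mat_eigenvalue (cmat W) \<mu> \<and> ?l \<mu> \<in> {l1, l2}}. gen_eigenspace (cmat W) \<mu>)"
        using M[OF \<mu>] by blast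
    qed
  qed
  have cnj_scale: "(\<chi> i. cnj ((c *s x) $ i)) = cnj c *s (\<chi> i. cnj (x $ i))" for c and x :: "complex^8"
    by (simp add: vec_eq_iff)
  \<comment> \<open>Since \<open>l1\<close> and \<open>l2\<close> are real and \<open>T\<close> is a
    real matrix, conjugation preserves each eigenspace of \<open>T\<close>. This does not depend on
    how \<open>b (cnj \<mu>)\<close> was chosen relative to \<open>b \<mu>\<close>.\<close>
  have conj_E: "(\<chi> i. cnj (y $ i)) \<in> E" if "y \<in> E" for y
    using that unfolding E
  proof (induction y rule: vec.span_induct_alt)
    case base
    have "(\<chi> i. cnj ((0::complex^8) $ i)) = 0" by (simp add: vec_eq_iff)
    thus ?case using vec.span_zero by simp
  next
    case (step c x y)
    then obtain \<mu> where \<mu>: "\<mu> \<in> M" "x = b \<mu>" by blast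
    let ?c = "\<lambda>x :: complex^8. \<chi> i. cnj (x $ i)"
    have "cnj (?l \<mu>) = ?l \<mu>" using M[OF \<mu>(1)] real by (auto simp only: Reals_cnj_iff insert_iff empty_iff)
    hence "T *v ?c x = ?l \<mu> *s ?c x"
      unfolding cmat_mult_cnj \<mu>(2) T_b[OF \<mu>(1)] cnj_scale by (simp only:)
    hence "?c x \<in> vec.span ?X" using T_eigenspace M[OF \<mu>(1)] by blast
    moreover have "?c (c *s x + y) = cnj c *s ?c x + ?c y" by (simp add: vec_eq_iff)
    ultimately show ?case using vec.span_add[OF vec.span_scale step.IH] by simp
  qed
  have V: "V = {x. cvec x \<in> E}" by (simp add: V_def stability_subspace_def E_def)
  have span_V: "vec.span (cvec ` V) = vec.span ?X"
    unfolding V by (subst span_cvec_real_points[OF _ conj_E]) (auto simp: E)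
  show "dim V = 4"
    unfolding dim_eq_vec_dim_cvec vec.dim_span[of "cvec ` V", symmetric] span_V
    using vec.dim_span_eq_card_independent[OF indep] card_image[OF inj] card_M by simp
  show "semisimple_on W V" unfolding semisimple_on_def
    using indep b by (intro exI[of _ ?X]) (auto simp: span_V)
  have "cmat (W ** W ** W ** W) *v b \<mu> = \<mu> ^ 4 *s b \<mu>" if "\<mu> \<in> M" for \<mu>
    using b(2)[OF that]
    by (simp add: cmat_mult vector_scalar_commute power4_eq_xxxx mult.assoc flip: matrix_vector_mul_assoc)
  thus "semisimple_on (W ** W ** W ** W) V" unfolding semisimple_on_def
    using indep by (intro exI[of _ ?X]) (auto simp: span_V)
qed

end


section \<open>Gradients, Hessians and equilibria\<close>

text \<open>Symmetry of the second derivative \<open>L z\<close> is part of the definition: it survives sums, products and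
  compositions, so no theorem on mixed partial derivatives is needed.\<close>

definition twice_differentiable_on :: "'a::real_inner set \<Rightarrow> ('a \<Rightarrow> real) \<Rightarrow> bool" where
  "twice_differentiable_on U f \<longleftrightarrow> (\<exists>G L. \<forall>z\<in>U. (f has_derivative (\<lambda>h. G z \<bullet> h)) (at z) \<and>
     (G has_derivative L z) (at z) \<and> (\<forall>h k. L z h \<bullet> k = h \<bullet> L z k))"

lemma twice_differentiable_onE:
  assumes "twice_differentiable_on U f"
  obtains G L where "\<And>z. z \<in> U \<Longrightarrow> (f has_derivative (\<lambda>h. G z \<bullet> h)) (at z)"
    "\<And>z. z \<in> U \<Longrightarrow> (G has_derivative L z) (at z)" "\<And>z h k. z \<in> U \<Longrightarrow> L z h \<bullet> k = h \<bullet> L z k"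
  using assms unfolding twice_differentiable_on_def by blast

lemma twice_differentiable_on_const: "twice_differentiable_on U (\<lambda>_. c)"
  unfolding twice_differentiable_on_def
  by (intro exI[of _ "\<lambda>_. 0"] exI[of _ "\<lambda>_ _. 0"])
    (auto intro!: has_derivative_eq_rhs[OF has_derivative_const])

lemma twice_differentiable_on_inner: "twice_differentiable_on U (\<lambda>z. a \<bullet> z)"
  unfolding twice_differentiable_on_def
  by (intro exI[of _ "\<lambda>_. a"] exI[of _ "\<lambda>_ _. 0"]) (auto intro!: derivative_eq_intros)

lemma twice_differentiable_on_nth: "twice_differentiable_on U (\<lambda>z :: real^'n. z $ i)"
  using twice_differentiable_on_inner[of U "axis i 1"] by (simp add: inner_axis')

lemma twice_differentiable_on_add:
  assumes "twice_differentiable_on U f" "twice_differentiable_on U g"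
  shows "twice_differentiable_on U (\<lambda>z. f z + g z)"
proof -
  from assms(1) obtain Gf Lf where f: "\<And>z. z \<in> U \<Longrightarrow> (f has_derivative (\<lambda>h. Gf z \<bullet> h)) (at z)"
    "\<And>z. z \<in> U \<Longrightarrow> (Gf has_derivative Lf z) (at z)" "\<And>z h k. z \<in> U \<Longrightarrow> Lf z h \<bullet> k = h \<bullet> Lf z k"
    by (rule twice_differentiable_onE) blast
  from assms(2) obtain Gg Lg where g: "\<And>z. z \<in> U \<Longrightarrow> (g has_derivative (\<lambda>h. Gg z \<bullet> h)) (at z)"
    "\<And>z. z \<in> U \<Longrightarrow> (Gg has_derivative Lg z) (at z)" "\<And>z h k. z \<in> U \<Longrightarrow> Lg z h \<bullet> k = h \<bullet> Lg z k"
    by (rule twice_differentiable_onE) blast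
  show ?thesis unfolding twice_differentiable_on_def
    by (intro exI[of _ "\<lambda>z. Gf z + Gg z"] exI[of _ "\<lambda>z h. Lf z h + Lg z h"])
      (auto intro!: derivative_eq_intros f g simp: inner_add f(3) g(3))
qed

lemma twice_differentiable_on_mult:
  assumes "twice_differentiable_on U f" "twice_differentiable_on U g"
  shows "twice_differentiable_on U (\<lambda>z. f z * g z)"
proof -
  from assms(1) obtain Gf Lf where f: "\<And>z. z \<in> U \<Longrightarrow> (f has_derivative (\<lambda>h. Gf z \<bullet> h)) (at z)"
    "\<And>z. z \<in> U \<Longrightarrow> (Gf has_derivative Lf z) (at z)" "\<And>z h k. z \<in> U \<Longrightarrow> Lf z h \<bullet> k = h \<bullet> Lf z k"
    by (rule twice_differentiable_onE) blast
  from assms(2) obtain Gg Lg where g: "\<And>z. z \<in> U \<Longrightarrow> (g has_derivative (\<lambda>h. Gg z \<bullet> h)) (at z)"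
    "\<And>z. z \<in> U \<Longrightarrow> (Gg has_derivative Lg z) (at z)" "\<And>z h k. z \<in> U \<Longrightarrow> Lg z h \<bullet> k = h \<bullet> Lg z k"
    by (rule twice_differentiable_onE) blast
  let ?G = "\<lambda>z. f z *\<^sub>R Gg z + g z *\<^sub>R Gf z"
  \<comment> \<open>Neither rank-one cross term is symmetric alone; they are adjoint to each other,
    so their sum is.\<close>
  let ?L = "\<lambda>z h. f z *\<^sub>R Lg z h + (Gf z \<bullet> h) *\<^sub>R Gg z + (g z *\<^sub>R Lf z h + (Gg z \<bullet> h) *\<^sub>R Gf z)"
  have "?L z h \<bullet> k = h \<bullet> ?L z k" if "z \<in> U" for z h k
    by (simp add: inner_add f(3)[OF that] g(3)[OF that] inner_commute[of h "Gf z"] inner_commute[of h "Gg z"])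
  moreover have "((\<lambda>z. f z * g z) has_derivative (\<lambda>h. ?G z \<bullet> h)) (at z)" if "z \<in> U" for z
    using f(1)[OF that] g(1)[OF that] by (auto intro!: derivative_eq_intros simp: inner_add algebra_simps)
  moreover have "(?G has_derivative ?L z) (at z)" if "z \<in> U" for z
    using f(1,2)[OF that] g(1,2)[OF that] by (auto intro!: derivative_eq_intros)
  ultimately show ?thesis unfolding twice_differentiable_on_def by (intro exI[of _ ?G] exI[of _ ?L]) blast
qed

lemma twice_differentiable_on_compose:
  assumes "twice_differentiable_on U f"
    and \<phi>: "\<And>z. z \<in> U \<Longrightarrow> (\<phi> has_real_derivative \<phi>' (f z)) (at (f z))"
    and \<phi>': "\<And>z. z \<in> U \<Longrightarrow> (\<phi>' has_real_derivative \<phi>'' (f z)) (at (f z))"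
  shows "twice_differentiable_on U (\<lambda>z. \<phi> (f z))"
proof -
  from assms(1) obtain G L where f: "\<And>z. z \<in> U \<Longrightarrow> (f has_derivative (\<lambda>h. G z \<bullet> h)) (at z)"
    "\<And>z. z \<in> U \<Longrightarrow> (G has_derivative L z) (at z)" "\<And>z h k. z \<in> U \<Longrightarrow> L z h \<bullet> k = h \<bullet> L z k"
    by (rule twice_differentiable_onE) blast
  have c: "((\<lambda>z. \<phi> (f z)) has_derivative (\<lambda>h. \<phi>' (f z) * (G z \<bullet> h))) (at z)"
    "((\<lambda>z. \<phi>' (f z)) has_derivative (\<lambda>h. \<phi>'' (f z) * (G z \<bullet> h))) (at z)" if "z \<in> U" for z
    using has_derivative_compose[OF f(1)[OF that] \<phi>[OF that, unfolded has_field_derivative_def]]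
      has_derivative_compose[OF f(1)[OF that] \<phi>'[OF that, unfolded has_field_derivative_def]] by simp_all
  let ?G = "\<lambda>z. \<phi>' (f z) *\<^sub>R G z"
  \<comment> \<open>The new term is a multiple of the projection-like map
    \<open>h \<mapsto> (G z \<bullet> h) *\<^sub>R G z\<close>, which is symmetric.\<close>
  let ?L = "\<lambda>z h. \<phi>' (f z) *\<^sub>R L z h + (\<phi>'' (f z) * (G z \<bullet> h)) *\<^sub>R G z"
  have "?L z h \<bullet> k = h \<bullet> ?L z k" if "z \<in> U" for z h k
    by (simp add: inner_add f(3)[OF that] inner_commute[of h "G z"])
  moreover have "((\<lambda>z. \<phi> (f z)) has_derivative (\<lambda>h. ?G z \<bullet> h)) (at z)" if "z \<in> U" for z
    using c(1)[OF that] by (simp add: inner_scaleR_left[abs_def])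
  moreover have "(?G has_derivative ?L z) (at z)" if "z \<in> U" for z
    using c(2)[OF that] f(2)[OF that] by (auto intro!: derivative_eq_intros)
  ultimately show ?thesis unfolding twice_differentiable_on_def by (intro exI[of _ ?G] exI[of _ ?L]) blast
qed

lemma twice_differentiable_on_inverse_sqrt:
  assumes "twice_differentiable_on U f" "\<And>z. z \<in> U \<Longrightarrow> f z > 0"
  shows "twice_differentiable_on U (\<lambda>z. 1 / sqrt (f z))"
proof -
  have "twice_differentiable_on U (\<lambda>z. inverse (sqrt (f z)))"
  proof (rule twice_differentiable_on_compose[OF assms(1)])
    fix z assume "z \<in> U"
    hence z: "f z > 0" by (rule assms)
    \<comment> \<open>Written as a cube of \<open>inverse (sqrt x)\<close>, the first derivative can
      be differentiated again by the power rule and itself.\<close>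
    let ?\<phi>' = "\<lambda>x. - (1/2) * (inverse (sqrt x))^3"
    have *: "((\<lambda>x. inverse (sqrt x)) has_real_derivative ?\<phi>' (f z)) (at (f z))"
      using z by (auto intro!: derivative_eq_intros simp: power3_eq_cube field_simps)
    then show "((\<lambda>x. inverse (sqrt x)) has_real_derivative ?\<phi>' (f z)) (at (f z))" .
    show "(?\<phi>' has_real_derivative - (1/2) * (3 * (inverse (sqrt (f z)))^2 * ?\<phi>' (f z))) (at (f z))"
      by (rule DERIV_cong[OF DERIV_cmult[OF DERIV_power[OF *, of 3]]]) simp
  qed
  thus ?thesis by (simp add: inverse_eq_divide)
qed

lemma twice_differentiable_on_power2: "twice_differentiable_on U f \<Longrightarrow> twice_differentiable_on U (\<lambda>z. (f z)\<^sup>2)"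
  unfolding power2_eq_square by (rule twice_differentiable_on_mult)

lemma twice_differentiable_on_diff:
  assumes "twice_differentiable_on U f" "twice_differentiable_on U g"
  shows "twice_differentiable_on U (\<lambda>z. f z - g z)"
  using twice_differentiable_on_add[OF assms(1) twice_differentiable_on_mult[OF twice_differentiable_on_const assms(2), of "-1"]] by simp

lemma twice_differentiable_on_divide_sqrt:
  assumes "twice_differentiable_on U f" "twice_differentiable_on U g" "\<And>z. z \<in> U \<Longrightarrow> g z > 0"
  shows "twice_differentiable_on U (\<lambda>z. f z / sqrt (g z))"
  using twice_differentiable_on_mult[OF assms(1) twice_differentiable_on_inverse_sqrt[OF assms(2,3)]] by simp

text \<open>Passes from the witnesses \<open>G\<close> and \<open>L\<close> to \<open>grad\<close>
  and \<open>hessian\<close>. As \<open>grad f\<close> agrees with \<open>G\<close> on all of the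
  open set \<open>U\<close>, it inherits the derivative.\<close>

lemma twice_differentiable_on_grad:
  fixes f :: "real^'n \<Rightarrow> real"
  assumes "open U" "twice_differentiable_on U f" "z \<in> U"
  shows "(f has_derivative (\<lambda>h. grad f z \<bullet> h)) (at z)"
    "(grad f has_derivative (*v) (hessian f z)) (at z)"
    "transpose (hessian f z) = hessian f z"
proof -
  from assms(2) obtain G L where f: "\<And>z. z \<in> U \<Longrightarrow> (f has_derivative (\<lambda>h. G z \<bullet> h)) (at z)"
    "\<And>z. z \<in> U \<Longrightarrow> (G has_derivative L z) (at z)" "\<And>z h k. z \<in> U \<Longrightarrow> L z h \<bullet> k = h \<bullet> L z k"
    by (rule twice_differentiable_onE) blast
  have grad: "grad f y = G y" if "y \<in> U" for y
    using frechet_derivative_at[OF f(1)[OF that], symmetric]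
    by (simp add: grad_def vec_eq_iff inner_axis)
  show "(f has_derivative (\<lambda>h. grad f z \<bullet> h)) (at z)" using f(1) grad assms(3) by simp
  have *: "(grad f has_derivative L z) (at z)"
    by (rule has_derivative_transform_within_open[OF f(2)[OF assms(3)] assms(1,3)]) (simp add: grad)
  hence hess: "hessian f z = matrix (L z)" by (simp add: hessian_def flip: frechet_derivative_at)
  have lin: "linear (L z)" using * has_derivative_linear by blast
  show "(grad f has_derivative (*v) (hessian f z)) (at z)"
    using * lin by (simp add: hess)
  have "L z (axis i 1) $ j = L z (axis j 1) $ i" for i j
    using f(3)[OF assms(3), of "axis i 1" "axis j 1"] by (simp add: inner_axis inner_axis')
  thus "transpose (hessian f z) = hessian f z"
    by (simp add: hess transpose_def matrix_def vec_eq_iff)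
qed

section \<open>Functions invariant under a linear map\<close>

lemma grad_invariant:
  fixes f :: "real^'n \<Rightarrow> real"
  assumes U: "open U" "twice_differentiable_on U f" "z \<in> U" "S *v z \<in> U" and inv: "\<And>z. f (S *v z) = f z"
  shows "grad f z = transpose S *v grad f (S *v z)"
proof -
  have "((\<lambda>z. f (S *v z)) has_derivative (\<lambda>h. grad f (S *v z) \<bullet> (S *v h))) (at z)"
    by (rule has_derivative_compose[where f = "(*v) S" and g = f])
      (auto intro: bounded_linear_imp_has_derivative twice_differentiable_on_grad(1) U)
  hence "(\<lambda>h. grad f z \<bullet> h) = (\<lambda>h. grad f (S *v z) \<bullet> (S *v h))"
    using twice_differentiable_on_grad(1)[OF U(1-3)] by (simp add: inv has_derivative_unique)
  hence "grad f z \<bullet> h = (transpose S *v grad f (S *v z)) \<bullet> h" for h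
    by (metis dot_lmul_matrix transpose_matrix_vector)
  thus ?thesis using vector_eq_rdot[of "grad f z" "transpose S *v grad f (S *v z)"] by blast
qed

text \<open>Differentiates the identity of \<open>grad_invariant\<close>, which must hold on a
  neighbourhood of \<open>z\<close>; hence \<open>S\<close> has to map \<open>U\<close> into
  itself.\<close>

lemma hessian_invariant:
  fixes f :: "real^'n \<Rightarrow> real"
  assumes U: "open U" "twice_differentiable_on U f" "z \<in> U" and SU: "\<And>z. z \<in> U \<Longrightarrow> S *v z \<in> U"
    and inv: "\<And>z. f (S *v z) = f z"
  shows "hessian f z = transpose S ** hessian f (S *v z) ** S"
proof -
  have "((\<lambda>z. grad f (S *v z)) has_derivative (\<lambda>h. hessian f (S *v z) *v (S *v h))) (at z)"
    by (rule has_derivative_compose[where f = "(*v) S" and g = "grad f"])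
      (auto intro: bounded_linear_imp_has_derivative twice_differentiable_on_grad(2) U SU)
  hence "((\<lambda>z. transpose S *v grad f (S *v z)) has_derivative
      (\<lambda>h. transpose S *v (hessian f (S *v z) *v (S *v h)))) (at z)"
    by (rule bounded_linear.has_derivative[OF matrix_vector_mul_bounded_linear])
  hence "(grad f has_derivative (\<lambda>h. transpose S *v (hessian f (S *v z) *v (S *v h)))) (at z)"
    by (rule has_derivative_transform_within_open[OF _ U(1,3)]) (simp add: grad_invariant[OF U(1,2) _ SU inv])
  hence "(*v) (hessian f z) = (\<lambda>h. transpose S *v (hessian f (S *v z) *v (S *v h)))"
    using twice_differentiable_on_grad(2)[OF U] has_derivative_unique by blast
  thus ?thesis by (simp add: matrix_eq fun_eq_iff matrix_vector_mul_assoc matrix_mul_assoc)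
qed

text \<open>The set of times at which \<gamma> equals \<open>p\<close> is closed by continuity and
  open by a Gronwall estimate for the squared distance to \<open>p\<close>, so it is the whole
  line.\<close>

lemma constant_if_equilibrium:
  fixes \<gamma> :: "real \<Rightarrow> 'a::real_inner"
  assumes ode: "\<And>s. (\<gamma> has_vector_derivative f (\<gamma> s)) (at s)"
    and f: "f differentiable at p" "f p = 0" and p: "\<gamma> t0 = p"
  shows "\<gamma> constant_on UNIV"
proof -
  \<comment> \<open>Differentiability at the zero \<open>p\<close> of \<open>f\<close> bounds
    \<open>f\<close> linearly near \<open>p\<close>, which replaces a Lipschitz condition.\<close>
  obtain B \<epsilon> where B: "\<epsilon> > 0" "\<And>z. norm (z - p) < \<epsilon> \<Longrightarrow> norm (f z) \<le> B * norm (z - p)"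
  proof -
    obtain D where D: "(f has_derivative D) (at p)" using f(1) by (auto simp: differentiable_def)
    obtain C where C: "\<And>x. norm (D x) \<le> norm x * C"
      using bounded_linear.bounded[OF has_derivative_bounded_linear[OF D]] by blast
    obtain d where d: "d > 0" "\<And>y. norm (y - p) < d \<Longrightarrow> norm (f y - f p - D (y - p)) \<le> 1 * norm (y - p)"
      using D[unfolded has_derivative_at_alt] zero_less_one by blast
    have "norm (f z) \<le> (C + 1) * norm (z - p)" if "norm (z - p) < d" for z
    proof -
      have "norm (f z) \<le> norm (f z - D (z - p)) + norm (D (z - p))"
        by (metis diff_add_cancel norm_triangle_ineq)
      also have "\<dots> \<le> norm (z - p) + norm (z - p) * C" using d(2)[OF that] C f(2) by (intro add_mono) auto
      finally show ?thesis by (simp add: algebra_simps)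
    qed
    with d(1) that show thesis by blast
  qed
  have cont: "continuous_on UNIV \<gamma>"
    using ode by (intro continuous_at_imp_continuous_on) (auto intro: has_vector_derivative_continuous)
  let ?C = "{s. \<gamma> s = p}"
  have "closed ?C" using cont by (intro closed_Collect_eq) auto
  moreover have "open ?C" unfolding open_contains_ball
  proof
    fix s0 assume "s0 \<in> ?C"
    hence s0: "\<gamma> s0 = p" by simp
    from cont have "isCont \<gamma> s0" by (simp add: continuous_on_eq_continuous_at)
    then obtain d where d: "d > 0" "\<And>s. dist s s0 < d \<Longrightarrow> norm (\<gamma> s - p) < \<epsilon>"
      using B(1) s0 unfolding continuous_at_eps_delta dist_norm by blast
    define g where "g s = (norm (\<gamma> s - p))\<^sup>2" for s
    define g' where "g' s = 2 * ((\<gamma> s - p) \<bullet> f (\<gamma> s))" for s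
    have deriv: "(g has_real_derivative g' s) (at s)" for s
    proof -
      have "(\<gamma> has_derivative (\<lambda>x. x *\<^sub>R f (\<gamma> s))) (at s)"
        using ode[of s] by (simp add: has_vector_derivative_def)
      thus ?thesis unfolding g_def g'_def power2_norm_eq_inner has_field_derivative_def
        by (auto intro!: derivative_eq_intros simp: inner_commute)
    qed
    have g': "\<bar>g' s\<bar> \<le> 2 * B * g s" if "dist s s0 < d" for s
    proof -
      have "\<bar>(\<gamma> s - p) \<bullet> f (\<gamma> s)\<bar> \<le> norm (\<gamma> s - p) * (B * norm (\<gamma> s - p))"
        by (rule order_trans[OF Cauchy_Schwarz_ineq2]) (intro mult_left_mono B d that norm_ge_zero)
      thus ?thesis by (simp add: g'_def g_def abs_mult power2_eq_square mult.left_commute[of _ B])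
    qed
    \<comment> \<open>Integrating factor for both time directions: \<open>c = - 2 B\<close> makes
      the product nonincreasing after \<open>s0\<close>, and \<open>c = 2 B\<close> makes it
      nondecreasing before \<open>s0\<close>.\<close>
    have exp_deriv: "((\<lambda>s. g s * exp (c * (s - s0))) has_real_derivative
        (g' s + c * g s) * exp (c * (s - s0))) (at s)" for c s
      using deriv[of s] by (auto intro!: derivative_eq_intros simp: algebra_simps)
    have "g s \<le> 0" if s: "dist s s0 < d" for s
    proof (cases "s0 \<le> s")
      case True
      have "g s * exp (- (2 * B) * (s - s0)) \<le> g s0 * exp (- (2 * B) * (s0 - s0))"
      proof (rule DERIV_nonpos_imp_nonincreasing[OF True])
        fix x assume "s0 \<le> x" "x \<le> s"
        hence "dist x s0 < d" using s by (auto simp: dist_real_def)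
        hence "(g' x + - (2 * B) * g x) * exp (- (2 * B) * (x - s0)) \<le> 0"
          using g'[of x] by (intro mult_nonpos_nonneg) auto
        thus "\<exists>y. ((\<lambda>s. g s * exp (- (2 * B) * (s - s0))) has_real_derivative y) (at x) \<and> y \<le> 0"
          using exp_deriv by blast
      qed
      thus ?thesis by (simp add: s0 g_def mult_le_0_iff)
    next
      case False
      hence le: "s \<le> s0" by simp
      have "g s * exp (2 * B * (s - s0)) \<le> g s0 * exp (2 * B * (s0 - s0))"
      proof (rule DERIV_nonneg_imp_nondecreasing[OF le])
        fix x assume "s \<le> x" "x \<le> s0"
        hence "dist x s0 < d" using s by (auto simp: dist_real_def)
        hence "(g' x + 2 * B * g x) * exp (2 * B * (x - s0)) \<ge> 0"
          using g'[of x] by (intro mult_nonneg_nonneg) auto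
        thus "\<exists>y. ((\<lambda>s. g s * exp (2 * B * (s - s0))) has_real_derivative y) (at x) \<and> 0 \<le> y"
          using exp_deriv by blast
      qed
      thus ?thesis by (simp add: s0 g_def mult_le_0_iff)
    qed
    hence "ball s0 d \<subseteq> ?C" by (auto simp: g_def dist_commute)
    with d(1) show "\<exists>e>0. ball s0 e \<subseteq> ?C" by blast
  qed
  ultimately have "?C = {} \<or> ?C = UNIV" using clopen[of ?C] by blast
  with p show ?thesis by (auto simp: constant_on_def)
qed


section \<open>Reversible linear Hamiltonian systems\<close>

lemma bounded_bilinear_matrix_mult:
  "bounded_bilinear ((**) :: real^'n^'m \<Rightarrow> real^'p^'n \<Rightarrow> real^'p^'m)"
  unfolding bilinear_conv_bounded_bilinear[symmetric] bilinear_def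
  by (auto intro!: linearI simp: vec_eq_iff matrix_matrix_mult_def sum_distrib_left algebra_simps sum.distrib)

lemma has_vector_derivative_matrix_mult_right:
  fixes Y :: "real \<Rightarrow> real^'n^'m"
  assumes "(Y has_vector_derivative Y') F"
  shows "((\<lambda>s. A ** Y s) has_vector_derivative A ** Y') F"
  by (rule bounded_linear.has_vector_derivative[OF bounded_bilinear.bounded_linear_right[OF bounded_bilinear_matrix_mult] assms])

lemma has_vector_derivative_transpose:
  fixes Y :: "real \<Rightarrow> real^'n^'m"
  assumes "(Y has_vector_derivative Y') F"
  shows "((\<lambda>s. transpose (Y s)) has_vector_derivative transpose Y') F"
proof -
  have "linear (transpose :: real^'n^'m \<Rightarrow> _)"
    by (auto intro!: linearI simp: vec_eq_iff transpose_def)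
  from bounded_linear.has_vector_derivative[OF linear_conv_bounded_linear[THEN iffD1, OF this] assms]
  show ?thesis .
qed

lemma matrix_minus_mult: "(- A) ** B = - (A ** B)" "A ** (- B) = - (A ** B)"
  for A :: "'a::ring_1^'n^'m"
  by (simp_all add: vec_eq_iff matrix_matrix_mult_def sum_negf)

lemma invertible_mult_left_cancel:
  fixes P :: "'a::semiring_1^'n^'n"
  assumes "invertible P" "P ** A = P ** B"
  shows "A = B"
  by (metis assms matrix_inv_left matrix_mul_assoc matrix_mul_lid)

text \<open>\<open>SF\<close> commutes with \<open>J\<close> and advances time by a quarter period.
  \<open>SG\<close> anticommutes with \<open>J\<close> and reverses time about \<open>pi/4\<close>,
  the fixed point of \<open>s \<mapsto> pi/2 - s\<close>.\<close>

locale reversible_linear_Hamiltonian_system =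
  fixes J SF SG :: "real^'n^'n" and H Y :: "real \<Rightarrow> real^'n^'n"
  assumes J: "transpose J = - J" "J ** J = - mat 1"
    and H: "\<And>s. transpose (H s) = H s"
    and Y: "\<And>s. (Y has_vector_derivative J ** H s ** Y s) (at s)"
    and Y_0: "invertible (Y 0)"
    and SF: "SF ** transpose SF = mat 1" "J ** SF = SF ** J" "\<And>s. SF ** H s = H (s + pi/2) ** SF"
      "SF ** SF ** SF ** SF = mat 1"
    and SG: "SG ** SG = mat 1" "J ** SG = - (SG ** J)" "\<And>s. SG ** H s = H (pi/2 - s) ** SG"
begin

text \<open>By symmetry of \<open>H\<close> and antisymmetry of \<open>J\<close> the two terms of
  the product rule are \<open>- X\<^sup>T H Z\<close> and \<open>X\<^sup>T H Z\<close>.\<close>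

lemma wronskian_constant:
  assumes Z: "\<And>s. (Z has_vector_derivative J ** H s ** Z s) (at s)"
    and X: "\<And>s. (X has_vector_derivative J ** H s ** X s) (at s)"
  shows "transpose (X s) ** (J ** Z s) = transpose (X 0) ** (J ** Z 0)"
proof -
  have "((\<lambda>s. transpose (X s) ** (J ** Z s)) has_vector_derivative 0) (at s within UNIV)" for s
  proof -
    have "transpose (X s) ** (J ** (J ** H s ** Z s)) + transpose (J ** H s ** X s) ** (J ** Z s)
        = transpose (X s) ** ((J ** J) ** H s ** Z s) - transpose (X s) ** H s ** (J ** J) ** Z s"
      by (simp add: matrix_transpose_mul J(1) H matrix_mul_assoc matrix_minus_mult)
    also have "\<dots> = 0"
      by (simp only: J(2) matrix_minus_mult matrix_mul_lid matrix_mul_rid) (simp add: matrix_mul_assoc)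
    finally show ?thesis
      using bounded_bilinear.has_vector_derivative[OF bounded_bilinear_matrix_mult
          has_vector_derivative_transpose[OF X[of s]] has_vector_derivative_matrix_mult_right[OF Z[of s], of J]]
      by simp
  qed
  then obtain c where "\<And>s. transpose (X s) ** (J ** Z s) = c"
    using has_vector_derivative_zero_constant[OF convex_UNIV, of "\<lambda>s. transpose (X s) ** (J ** Z s)"]
    by (metis UNIV_I)
  thus ?thesis by simp
qed

lemma invertible_J: "invertible J"
  using J(2) by (auto simp: invertible_right_inverse matrix_minus_mult intro!: exI[of _ "- J"])

text \<open>The constant \<open>Y(s)\<^sup>T J Y(s)\<close> is invertible at \<open>s = 0\<close>,
  so multiplying by its inverse exhibits a left inverse of \<open>Y(s)\<close>.\<close>

lemma invertible_Y: "invertible (Y s)"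
proof -
  define \<Omega> where "\<Omega> = transpose (Y 0) ** (J ** Y 0)"
  have "invertible \<Omega>" unfolding \<Omega>_def
    by (intro invertible_mult transpose_invertible invertible_J Y_0)
  then obtain R where "R ** \<Omega> = mat 1" by (auto simp: invertible_def)
  moreover have "\<Omega> = transpose (Y s) ** J ** Y s"
    unfolding \<Omega>_def using wronskian_constant[OF Y Y, of s] by (simp add: matrix_mul_assoc)
  ultimately have "R ** (transpose (Y s) ** J) ** Y s = mat 1" by (simp add: matrix_mul_assoc)
  thus ?thesis unfolding invertible_left_inverse by blast
qed

text \<open>Both sides have the same Wronskian with \<open>Y\<close>, and the factor
  \<open>Y(s)\<^sup>T J\<close> can be cancelled.\<close>

lemma solution_unique:
  assumes Z: "\<And>s. (Z has_vector_derivative J ** H s ** Z s) (at s)"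
  shows "Z s = Y s ** (matrix_inv (Y 0) ** Z 0)"
proof -
  let ?P = "transpose (Y s) ** J"
  have "?P ** Z s = transpose (Y 0) ** J ** Z 0"
    using wronskian_constant[OF Z Y, of s] by (simp add: matrix_mul_assoc)
  also have "\<dots> = transpose (Y 0) ** J ** (Y 0 ** matrix_inv (Y 0)) ** Z 0"
    by (simp add: matrix_inv_right[OF Y_0])
  also have "\<dots> = ?P ** (Y s ** (matrix_inv (Y 0) ** Z 0))"
    using wronskian_constant[OF Y Y, of s] by (simp add: matrix_mul_assoc)
  finally have eq: "?P ** Z s = ?P ** (Y s ** (matrix_inv (Y 0) ** Z 0))" .
  have "invertible ?P" by (intro invertible_mult transpose_invertible invertible_J invertible_Y)
  from invertible_mult_left_cancel[OF this eq] show ?thesis .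
qed

lemma transpose_SF: "transpose SF ** SF = mat 1"
  using SF(1) matrix_left_right_inverse by blast

text \<open>Shifting time and undoing the shift by \<open>SF\<^sup>T\<close> yields another
  solution, so it is \<open>Y\<close> times a constant matrix, read off at
  \<open>s = 0\<close>.\<close>

lemma Y_shift: "Y (s + pi/2) = SF ** Y s ** (matrix_inv (Y 0) ** transpose SF ** Y (pi/2))"
proof -
  let ?Z = "\<lambda>s. transpose SF ** Y (s + pi/2)"
  have "(?Z has_vector_derivative J ** H s ** ?Z s) (at s)" for s
  proof -
    have "((\<lambda>s. s + pi/2) has_vector_derivative 1) (at s)"
      by (auto intro!: derivative_eq_intros simp flip: has_real_derivative_iff_has_vector_derivative)
    from vector_diff_chain_at[OF this Y]
    have "((\<lambda>s. Y (s + pi/2)) has_vector_derivative J ** H (s + pi/2) ** Y (s + pi/2)) (at s)"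
      by (simp add: o_def)
    from has_vector_derivative_matrix_mult_right[OF this]
    have "(?Z has_vector_derivative transpose SF ** (J ** H (s + pi/2) ** Y (s + pi/2))) (at s)" .
    also have "H (s + pi/2) = SF ** H s ** transpose SF"
      by (metis SF(1,3) matrix_mul_assoc matrix_mul_rid)
    also have "transpose SF ** (J ** (SF ** H s ** transpose SF) ** Y (s + pi/2))
        = transpose SF ** (J ** SF) ** H s ** ?Z s" by (simp add: matrix_mul_assoc)
    also have "\<dots> = J ** H s ** ?Z s" by (simp only: SF(2) matrix_mul_assoc transpose_SF matrix_mul_lid)
    finally show ?thesis .
  qed
  from solution_unique[OF this, of s]
  have "SF ** (transpose SF ** Y (s + pi/2)) = SF ** (Y s ** (matrix_inv (Y 0) ** (transpose SF ** Y (0 + pi/2))))"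
    by simp
  thus ?thesis by (simp add: matrix_mul_assoc SF(1))
qed

lemma Y_reflect:
  "Y (pi/2) = SG ** Y 0 ** (matrix_inv (Y (pi/4)) ** SG ** Y (pi/4))"
proof -
  let ?Z = "\<lambda>s. SG ** Y (pi/2 - s)"
  have "(?Z has_vector_derivative J ** H s ** ?Z s) (at s)" for s
  proof -
    have "((\<lambda>s. pi/2 - s) has_vector_derivative -1) (at s)"
      by (auto intro!: derivative_eq_intros simp flip: has_real_derivative_iff_has_vector_derivative)
    from vector_diff_chain_at[OF this Y]
    have "((\<lambda>s. Y (pi/2 - s)) has_vector_derivative - (J ** H (pi/2 - s) ** Y (pi/2 - s))) (at s)"
      by (simp add: o_def)
    from has_vector_derivative_matrix_mult_right[OF this]
    have "(?Z has_vector_derivative SG ** - (J ** H (pi/2 - s) ** Y (pi/2 - s))) (at s)" .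
    also have "H (pi/2 - s) = SG ** H s ** SG"
      by (metis SG(1,3) matrix_mul_assoc matrix_mul_rid)
    \<comment> \<open>The minus sign from reversing time is cancelled by the one from anticommuting
      \<open>SG\<close> past \<open>J\<close>.\<close>
    also have "SG ** - (J ** (SG ** H s ** SG) ** Y (pi/2 - s))
        = - (SG ** (J ** SG) ** H s ** ?Z s)" by (simp add: matrix_mul_assoc matrix_minus_mult)
    also have "\<dots> = J ** H s ** ?Z s"
      by (simp only: SG(1,2) matrix_mul_assoc matrix_minus_mult matrix_mul_lid) simp
    finally show ?thesis .
  qed
  note Z = solution_unique[OF this]
  \<comment> \<open>The constant linking \<open>?Z\<close> to \<open>Y\<close>. At
    \<open>s = pi/4\<close> both involve the same \<open>Y (pi/4)\<close>, which determines it; at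
    \<open>s = 0\<close> it then gives \<open>Y (pi/2)\<close>.\<close>
  let ?C = "matrix_inv (Y 0) ** (SG ** Y (pi/2 - 0))"
  have "matrix_inv (Y (pi/4)) ** (SG ** Y (pi/4)) = matrix_inv (Y (pi/4)) ** (Y (pi/4) ** ?C)"
    using Z[of "pi/4"] by simp
  hence "?C = matrix_inv (Y (pi/4)) ** SG ** Y (pi/4)"
    by (simp add: matrix_mul_assoc matrix_inv_left[OF invertible_Y])
  with Z[of 0] have "SG ** (SG ** Y (pi/2)) = SG ** (Y 0 ** (matrix_inv (Y (pi/4)) ** SG ** Y (pi/4)))"
    by simp
  thus ?thesis by (simp add: matrix_mul_assoc SG(1))
qed

text \<open>The product of \<Lambda> and \<open>D\<close>. Up to \<open>SF\<close> it advances
  solutions by a quarter period: \<open>Y (s + pi/2) = SF ** Y s ** W\<close>.\<close>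

definition "W = matrix_inv (Y 0) ** transpose SF ** SG ** Y 0 ** (matrix_inv (Y (pi/4)) ** SG ** Y (pi/4))"

lemma invertible_W: "invertible W"
proof -
  have "invertible SG" using SG(1) unfolding invertible_def by blast
  moreover have "invertible (transpose SF)" using SF(1) transpose_SF unfolding invertible_def by blast
  moreover have "invertible (matrix_inv (Y s))" for s
    using matrix_inv_left[OF invertible_Y] matrix_inv_right[OF invertible_Y] unfolding invertible_def by blast
  ultimately show ?thesis unfolding W_def by (intro invertible_mult invertible_Y)
qed

text \<open>Four quarter-period steps collect four factors \<open>SF\<close> on the left, which
  cancel, and four factors \<open>W\<close> on the right.\<close>

lemma monodromy: "matrix_inv (Y 0) ** Y (2 * pi) = W ** W ** W ** W"
proof -
  have step: "Y (s + pi/2) = SF ** Y s ** W" for s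
    unfolding Y_shift[of s] W_def by (subst Y_reflect) (simp add: matrix_mul_assoc)
  have "Y (2 * pi) = Y (0 + pi/2 + pi/2 + pi/2 + pi/2)" by simp
  also have "\<dots> = (SF ** SF ** SF ** SF) ** Y 0 ** (W ** W ** W ** W)"
    unfolding step by (simp add: matrix_mul_assoc)
  finally show ?thesis by (simp add: SF(4) matrix_mul_assoc matrix_inv_left[OF Y_0])
qed

end


section \<open>The symmetric periodic orbit\<close>

lemma J_vector_mult: "J *v z = vector [z$5, z$6, z$7, z$8, - z$1, - z$2, - z$3, - z$4]"
  by (simp add: vec_eq_iff forall_8 J_def block4_def mat_def matrix_vector_mult_def sum_8)

lemma S_F_vector_mult: "S_F *v z = vector [- z$3, z$4, z$1, - z$2, - z$7, z$8, z$5, - z$6]"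
  by (simp add: vec_eq_iff forall_8 S_F_def block4_def block2_def matF_def matrix_vector_mult_def sum_8)

lemma S_G_vector_mult: "S_G *v z = vector [- z$1, - z$2, z$3, z$4, z$5, z$6, - z$7, - z$8]"
  by (simp add: vec_eq_iff forall_8 S_G_def block4_def block2_def matG_def mat_def matrix_vector_mult_def sum_8)

lemma transpose_J: "transpose J = - J"
  by (simp add: vec_eq_iff forall_8 J_def block4_def mat_def transpose_def)

lemma transpose_S_F: "transpose S_F = - S_F"
  by (simp add: vec_eq_iff forall_8 S_F_def block4_def block2_def matF_def transpose_def)

lemma transpose_S_G: "transpose S_G = S_G"
  by (simp add: vec_eq_iff forall_8 S_G_def block4_def block2_def matG_def mat_def transpose_def)

lemma minus_matrix_vector_mult: "(- A) *v x = - (A *v x)" for A :: "'a::ring_1^'n^'m"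
  by (simp add: vec_eq_iff matrix_vector_mult_def sum_negf)

lemma symmetry_matrices:
  "J ** J = - mat 1" "S_F ** transpose S_F = mat 1" "J ** S_F = S_F ** J"
  "S_F ** S_F ** S_F ** S_F = mat 1" "S_G ** S_G = mat 1" "J ** S_G = - (S_G ** J)"
  unfolding transpose_S_F matrix_eq
  by (simp_all add: minus_matrix_vector_mult vec_eq_iff forall_8 J_vector_mult S_F_vector_mult S_G_vector_mult
      flip: matrix_vector_mul_assoc)

text \<open>The signs occur only inside squares or in pairs in \<open>M3 M1\<close> and
  \<open>M4 M2\<close>, so the Hamiltonian is unchanged.\<close>

lemma M_S_F:
  "M1 (S_F *v z) = M3 z" "M2 (S_F *v z) = - M4 z" "M3 (S_F *v z) = M1 z" "M4 (S_F *v z) = - M2 z"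
  "M5 (S_F *v z) = M5 z" "M6 (S_F *v z) = - M6 z" "M7 (S_F *v z) = - M7 z" "M8 (S_F *v z) = M8 z"
  by (simp_all add: M1_def M2_def M3_def M4_def M5_def M6_def M7_def M8_def S_F_vector_mult)

lemma M_S_G:
  "M1 (S_G *v z) = - M1 z" "M2 (S_G *v z) = - M2 z" "M3 (S_G *v z) = - M3 z" "M4 (S_G *v z) = - M4 z"
  "M5 (S_G *v z) = M5 z" "M6 (S_G *v z) = M6 z" "M7 (S_G *v z) = M7 z" "M8 (S_G *v z) = M8 z"
  by (simp_all add: M1_def M2_def M3_def M4_def M5_def M6_def M7_def M8_def S_G_vector_mult)

lemma Hamiltonian_S_F: "Hamiltonian m E (S_F *v z) = Hamiltonian m E z"
  unfolding Hamiltonian_def M_S_F by (simp add: S_F_vector_mult algebra_simps)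

lemma Hamiltonian_S_G: "Hamiltonian m E (S_G *v z) = Hamiltonian m E z"
  unfolding Hamiltonian_def M_S_G by (simp add: S_G_vector_mult)

text \<open>With \<open>w1 = u1 + i u2\<close> and \<open>w2 = u3 + i u4\<close> the two sums are
  the squared moduli of \<open>w1\<^sup>2 + w2\<^sup>2\<close> and
  \<open>w1\<^sup>2 - w2\<^sup>2\<close>. Hence states with \<open>w1 = 0\<close> or
  \<open>w2 = 0\<close>, but not both, are included.\<close>

definition regular :: "(real^8) set" where
  "regular = {z. (M5 z)\<^sup>2 + (M6 z)\<^sup>2 \<noteq> 0 \<and> (M7 z)\<^sup>2 + (M8 z)\<^sup>2 \<noteq> 0}"

lemma open_regular: "open regular"
  unfolding regular_def M5_def M6_def M7_def M8_def
  by (intro open_Collect_conj open_Collect_neq continuous_intros)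

lemma S_F_regular: "z \<in> regular \<Longrightarrow> S_F *v z \<in> regular"
  by (simp add: regular_def M_S_F)

lemma S_G_regular: "z \<in> regular \<Longrightarrow> S_G *v z \<in> regular"
  by (simp add: regular_def M_S_G)

lemma twice_differentiable_on_Hamiltonian: "twice_differentiable_on regular (Hamiltonian m E)"
proof -
  have pos: "(M5 z)\<^sup>2 + (M6 z)\<^sup>2 > 0" "(M7 z)\<^sup>2 + (M8 z)\<^sup>2 > 0" if "z \<in> regular" for z
    using that by (auto simp: regular_def sum_power2_gt_zero_iff)
  show ?thesis
    unfolding Hamiltonian_def M1_def M2_def M3_def M4_def M5_def M6_def M7_def M8_def
    by (intro twice_differentiable_on_diff twice_differentiable_on_add twice_differentiable_on_divide_sqrt twice_differentiable_on_mult
        twice_differentiable_on_power2 twice_differentiable_on_nth twice_differentiable_on_const)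
      (use pos in \<open>simp_all add: M5_def M6_def M7_def M8_def\<close>)
qed

text \<open>The rows are pairwise orthogonal with the same squared length, so the transpose is a
  multiple of the inverse.\<close>

lemma invertible_Y0_pattern:
  fixes a b c d :: real
  assumes "a\<^sup>2 + b\<^sup>2 + c\<^sup>2 + d\<^sup>2 \<noteq> 0"
  shows "invertible (vector
      [vector [ c,  d,  a,  b,  a, -b, -c,  d],
       vector [ d, -c,  b, -a,  b,  a, -d, -c],
       vector [ c,  d,  a,  b, -a,  b,  c, -d],
       vector [-d,  c, -b,  a,  b,  a, -d, -c],
       vector [-a,  b,  c, -d,  c,  d,  a,  b],
       vector [-b, -a,  d,  c,  d, -c,  b, -a],
       vector [ a, -b, -c,  d,  c,  d,  a,  b],
       vector [-b, -a,  d,  c, -d,  c, -b,  a]] :: real^8^8)" (is "invertible ?N")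
proof -
  let ?k = "2 * (a\<^sup>2 + b\<^sup>2 + c\<^sup>2 + d\<^sup>2)"
  have NT: "?N ** transpose ?N = ?k *\<^sub>R mat 1"
    unfolding vec_eq_iff forall_8
    by (simp add: matrix_matrix_mult_def transpose_def sum_8 mat_def power2_eq_square)
  have "?N ** ((1 / ?k) *\<^sub>R transpose ?N) = (1 / ?k) *\<^sub>R (?k *\<^sub>R mat 1)"
    by (simp only: matrix_scalar_ac scalar_matrix_assoc[symmetric] NT)
  also have "\<dots> = mat 1" using assms by (simp only: scaleR_scaleR) simp
  finally show ?thesis unfolding invertible_right_inverse by blast
qed

section \<open>Linearization along the symmetric orbit\<close>

locale SBC_orbit =
  fixes m E :: real and \<gamma> :: "real \<Rightarrow> real^8" and Y :: "real \<Rightarrow> real^8^8"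
  assumes orbit: "symmetric_SBC_orbit m E \<gamma>" and lin: "linearized_solution m E \<gamma> Y"
begin

abbreviation "\<Gamma> \<equiv> Hamiltonian m E"

lemma ode: "(\<gamma> has_vector_derivative J *v grad \<Gamma> (\<gamma> s)) (at s)"
  and S_F_orbit: "S_F *v \<gamma> s = \<gamma> (s + pi/2)" and S_G_orbit: "S_G *v \<gamma> s = \<gamma> (pi/2 - s)"
  and regular_orbit: "\<gamma> s \<in> regular" and nonconstant: "\<not> \<gamma> constant_on UNIV"
  using orbit unfolding symmetric_SBC_orbit_def regular_def by blast+

lemma velocity_nonzero: "J *v grad \<Gamma> (\<gamma> 0) \<noteq> 0"
proof
  assume "J *v grad \<Gamma> (\<gamma> 0) = 0"
  moreover have "((\<lambda>z. J *v grad \<Gamma> z) has_derivative (\<lambda>h. J *v (hessian \<Gamma> (\<gamma> 0) *v h))) (at (\<gamma> 0))"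
    by (rule bounded_linear.has_derivative[OF matrix_vector_mul_bounded_linear
          twice_differentiable_on_grad(2)[OF open_regular twice_differentiable_on_Hamiltonian regular_orbit]])
  ultimately have "\<gamma> constant_on UNIV"
    using constant_if_equilibrium[of \<gamma> "\<lambda>z. J *v grad \<Gamma> z" "\<gamma> 0" 0] ode by (auto simp: differentiable_def)
  with nonconstant show False by blast
qed

lemma invertible_Y0: "invertible (Y0 \<gamma>)"
proof -
  define w where "w = J *v grad \<Gamma> (\<gamma> 0)"
  have w: "(\<gamma> has_vector_derivative w) (at 0)" using ode[of 0] by (simp add: w_def)
  \<comment> \<open>The two symmetries combine to
    \<open>S_F *v \<gamma> (- s) = S_G *v \<gamma> s\<close>; its derivative at 0 expresses the
    velocity through components 1, 2, 5 and 6 alone, the entries \<open>a\<close>, \<open>b\<close>,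
    \<open>c\<close>, \<open>d\<close> of \<open>Y0\<close>.\<close>
  have "((\<lambda>s. \<gamma> (- s)) has_vector_derivative - w) (at 0)"
  proof -
    have "((\<lambda>s. - s) has_vector_derivative -1) (at (0::real))"
      by (auto intro!: derivative_eq_intros simp flip: has_real_derivative_iff_has_vector_derivative)
    from vector_diff_chain_at[OF this, of \<gamma> w] w show ?thesis by (simp add: o_def)
  qed
  hence "((\<lambda>s. S_F *v \<gamma> (- s)) has_vector_derivative S_F *v (- w)) (at 0)"
    by (rule bounded_linear.has_vector_derivative[OF matrix_vector_mul_bounded_linear])
  moreover have "((\<lambda>s. S_G *v \<gamma> s) has_vector_derivative S_G *v w) (at 0)"
    by (rule bounded_linear.has_vector_derivative[OF matrix_vector_mul_bounded_linear w])
  moreover have "(\<lambda>s. S_F *v \<gamma> (- s)) = (\<lambda>s. S_G *v \<gamma> s)"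
    by (simp add: S_F_orbit S_G_orbit)
  ultimately have "S_F *v (- w) = S_G *v w" using vector_derivative_unique_at by metis
  hence "(S_F *v (- w)) $ i = (S_G *v w) $ i" for i by simp
  from this[of 1] this[of 2] this[of 5] this[of 6]
  have eqs: "w$3 = - w$1" "w$4 = w$2" "w$7 = w$5" "w$8 = - w$6"
    by (simp_all add: S_F_vector_mult S_G_vector_mult)
  have "w \<noteq> 0" using velocity_nonzero by (simp add: w_def)
  hence "(w$1)\<^sup>2 + (w$2)\<^sup>2 + (w$5)\<^sup>2 + (w$6)\<^sup>2 \<noteq> 0"
    by (auto simp: vec_eq_iff forall_8 eqs add_nonneg_eq_0_iff)
  moreover have "vector_derivative \<gamma> (at 0) = w" using w by (rule vector_derivative_at)
  ultimately show ?thesis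
    unfolding Y0_def Let_def using \<open>w \<noteq> 0\<close> by (simp only:) (intro scalar_invertible invertible_Y0_pattern, simp_all)
qed

lemma Y_at_0: "Y 0 = Y0 \<gamma>"
  and Y_deriv: "(Y has_vector_derivative J ** hessian \<Gamma> (\<gamma> s) ** Y s) (at s)"
  using lin unfolding linearized_solution_def by blast+

lemma hessian_S_F: "S_F ** hessian \<Gamma> (\<gamma> s) = hessian \<Gamma> (\<gamma> (s + pi/2)) ** S_F"
proof -
  have "hessian \<Gamma> (\<gamma> s) = transpose S_F ** hessian \<Gamma> (S_F *v \<gamma> s) ** S_F"
    by (rule hessian_invariant[OF open_regular twice_differentiable_on_Hamiltonian regular_orbit])
      (simp_all only: S_F_regular Hamiltonian_S_F)
  hence "S_F ** hessian \<Gamma> (\<gamma> s) = (S_F ** transpose S_F) ** hessian \<Gamma> (\<gamma> (s + pi/2)) ** S_F"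
    by (simp only: S_F_orbit matrix_mul_assoc)
  thus ?thesis by (simp only: symmetry_matrices(2) matrix_mul_lid)
qed

lemma hessian_S_G: "S_G ** hessian \<Gamma> (\<gamma> s) = hessian \<Gamma> (\<gamma> (pi/2 - s)) ** S_G"
proof -
  have "hessian \<Gamma> (\<gamma> s) = transpose S_G ** hessian \<Gamma> (S_G *v \<gamma> s) ** S_G"
    by (rule hessian_invariant[OF open_regular twice_differentiable_on_Hamiltonian regular_orbit])
      (simp_all only: S_G_regular Hamiltonian_S_G)
  hence "S_G ** hessian \<Gamma> (\<gamma> s) = (S_G ** transpose S_G) ** hessian \<Gamma> (\<gamma> (pi/2 - s)) ** S_G"
    by (simp only: S_G_orbit matrix_mul_assoc)
  thus ?thesis by (simp only: transpose_S_G symmetry_matrices(5) matrix_mul_lid)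
qed

sublocale reversible_linear_Hamiltonian_system J S_F S_G "\<lambda>s. hessian \<Gamma> (\<gamma> s)" Y
  by unfold_locales
    (simp_all only: transpose_J symmetry_matrices Y_deriv Y_at_0 invertible_Y0 hessian_S_F hessian_S_G
      twice_differentiable_on_grad(3)[OF open_regular twice_differentiable_on_Hamiltonian regular_orbit])

lemma mat_W_eq: "mat_W \<gamma> Y = W"
  by (simp add: mat_W_def mat_Lambda_def mat_D_def W_def Y_at_0 matrix_mul_assoc)

end

theorem theorem3p5:
  fixes m E :: real
    and \<gamma> :: "real \<Rightarrow> real^8"
    and Y :: "real \<Rightarrow> real^8^8"
    and K :: "real^4^4"
    and l1 l2 :: complex
  assumes "0 < m" and "m \<le> 1"
    and "symmetric_SBC_orbit m E \<gamma>"
    and "linearized_solution m E \<gamma> Y"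
    and "is_mat_K \<gamma> Y K"
    and "mat_eigenvalue (cmat K) (-1)"
    and "proots (charpoly (cmat K)) - {#1, -1#} = {#l1, l2#}"
  shows "(spectrally_stable \<gamma> Y \<longleftrightarrow>
            l1 \<in> \<real> \<and> l2 \<in> \<real> \<and> cmod l1 \<le> 1 \<and> cmod l2 \<le> 1) \<and>
         (l1 \<in> \<real> \<and> l2 \<in> \<real> \<and> l1 \<noteq> l2 \<and> cmod l1 < 1 \<and> cmod l2 < 1 \<and>
          {l1, l2} \<inter> {0, complex_of_real (1 / sqrt 2), - complex_of_real (1 / sqrt 2)} = {} \<longrightarrow>
          linearly_stable \<gamma> Y l1 l2)"
proof -
  interpret SBC_orbit m E \<gamma> Y by unfold_locales (fact assms)+
  interpret WK: block_diagonal_mean "mat_W \<gamma> Y" K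
    by unfold_locales (use assms(5) invertible_W in \<open>simp_all add: mat_W_eq is_mat_K_def\<close>)
  \<comment> \<open>Away from 1 and -1 the subtraction leaves all multiplicities unchanged.\<close>
  have "l \<in># proots (charpoly (cmat K)) \<longleftrightarrow> l \<in> {1, -1, l1, l2}" if "l \<noteq> 1" "l \<noteq> -1" for l
  proof -
    have "count (proots (charpoly (cmat K)) - {#1, -1#}) l = count (proots (charpoly (cmat K))) l"
      using that by simp
    hence "l \<in># proots (charpoly (cmat K)) \<longleftrightarrow> l \<in># {#l1, l2#}"
      unfolding assms(7) by (metis count_eq_zero_iff)
    thus ?thesis using that by auto
  qed
  hence eigenvalue_K: "mat_eigenvalue (cmat K) l \<longleftrightarrow> l \<in> {l1, l2}" if "l \<noteq> 1" "l \<noteq> -1" for l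
    using that by (simp add: mat_eigenvalue_iff_proots)
  have "spectrally_stable \<gamma> Y \<longleftrightarrow> (\<forall>l. mat_eigenvalue (cmat K) l \<longrightarrow> l \<in> \<real> \<and> cmod l \<le> 1)"
    unfolding spectrally_stable_def char_multiplier_def Y_at_0[symmetric] monodromy mat_W_eq[symmetric]
    by (rule WK.eigenvalue_W4_unit_iff)
  also have "\<dots> \<longleftrightarrow> (\<forall>l\<in>{l1, l2}. l \<in> \<real> \<and> cmod l \<le> 1)"
    (is "?A \<longleftrightarrow> ?B")
  \<comment> \<open>The values 1 and -1 satisfy the bound in any case, so they do not disturb the
    comparison.\<close>
  proof (intro iffI ballI allI impI)
    fix l assume ?A "l \<in> {l1, l2}"
    thus "l \<in> \<real> \<and> cmod l \<le> 1" using eigenvalue_K[of l] by (cases "l = 1 \<or> l = -1") auto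
  next
    fix l assume ?B "mat_eigenvalue (cmat K) l"
    thus "l \<in> \<real> \<and> cmod l \<le> 1" using eigenvalue_K[of l] by (cases "l = 1 \<or> l = -1") auto
  qed
  finally have spectral: "spectrally_stable \<gamma> Y \<longleftrightarrow> l1 \<in> \<real> \<and> l2 \<in> \<real> \<and> cmod l1 \<le> 1 \<and> cmod l2 \<le> 1"
    by auto
  moreover have "linearly_stable \<gamma> Y l1 l2"
    if "l1 \<in> \<real>" "l2 \<in> \<real>" "l1 \<noteq> l2" "cmod l1 < 1" "cmod l2 < 1"
  proof -
    interpret simple_block_diagonal_mean "mat_W \<gamma> Y" K l1 l2
      by unfold_locales (use assms(6,7) that in simp_all)
    show ?thesis unfolding linearly_stable_def Let_def
      using linear_stability spectral that by auto
  qed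
  ultimately show ?thesis by blast
qed

end
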